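(* Let $\mathcal M=(M,\rho)$ be an arbitrary finite metric space, $M=\{p_1,\dots,p_n\}$, $d_{ij}=\rho(p_i,p_j)$, and let $G=(V,E)$ be an arbitrary binary tree connecting $M$ (so that $M$ is exactly the set of vertices of $G$ of degree $1$). Then the weight $\mathrm{mpf}_{-}(\mathcal M,G)$ of the generalized minimal parametric filling of type $G$ of $\mathcal M$ is equal to the maximal value of the objective function $H(\lambda)=\sum_{1\le i<j\le n} d_{ij}\lambda_{ij}$ on the vertices of the polyhedral set $\Lambda_G$. Moreover, if $\lambda$ is a vertex of $\Lambda_G$ at which this maximum is attained, then $\mathrm{mpf}_{-}(\mathcal M,G)$ equals the multi-perimeter of a multi-tour of $G$ that corresponds to $\lambda$ (that is, of a multi-tour $\pi$ of some multiplicity $k$ with $\lambda=\frac1{2k}w^{\pi}$; such a multi-tour exists).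
   Context: A binary tree is a finite tree all of whose vertices have degree $1$ or $3$; its boundary is the set of all its vertices of degree $1$. A binary tree $G$ connects $M$ if its boundary is $M$. Generalized fillings. For $u,v\in M$ let $\gamma(u,v)$ denote the unique path in $G$ joining $u$ and $v$ (write $\gamma(i,j)$ for $\gamma(p_i,p_j)$). A function $\omega\colon E\to\mathbb R$ (negative values allowed) makes $G$ a generalized filling of $\mathcal M$ if $\sum_{e\in\gamma(i,j)}\omega(e)\ge d_{ij}$ for all $1\le i<j\le n$. Then $\mathrm{mpf}_{-}(\mathcal M,G)$ is the infimum of $\sum_{e\in E}\omega(e)$ over all such $\omega$. Polyhedron $\Lambda_G$. Each edge $e\in E$ generates a partition $\mathcal P_G(e)=\{M_1,M_2\}$ of $M$, where $M_1,M_2$ are the sets of elements of $M$ lying in the two connected components obtained by deleting $e$ from $G$. The set $\Lambda_G\subset\mathbb R^{n(n-1)/2}$ consists of all vectors $\lambda=(\lambda_{ij})_{1\le i<j\le n}$ with $\lambda_{ij}\ge0$ and, for every $e\in E$, $\sum\lambda_{ij}=1$, where the sum is over all $i<j$ such that $p_i$ and $p_j$ lie in different elements of $\mathcal P_G(e)$. Vertices of $\Lambda_G$ are its extreme points. Multi-tours. A multi-cyclic order of multiplicity $k$ on $M$ ($k$ a positive integer) is a map $\pi\colon\mathbb Z_{nk}\to M$ (where $\mathbb Z_{nk}=\mathbb Z/nk\mathbb Z$) such that $\pi(j)\ne\pi(j+1)$ for all $j$ and every element of $M$ has exactly $k$ preimages. It is a multi-tour of $G$ if there is a positive integer $m$ such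 that for every $e\in E$ and every $M_i\in\mathcal P_G(e)$ there are exactly $m$ elements $p\in\mathbb Z_{nk}$ with $\pi(p)\in M_i$ and $\pi(p+1)\notin M_i$; $m$ is called the multiplicity of the multi-tour, and it is known that then $m=k$. For a multi-tour $\pi$, $w^\pi\in\mathbb R^{n(n-1)/2}$ is the vector whose component $w^\pi_{ij}$ ($i<j$) is the number of $t\in\mathbb Z_{nk}$ with $\{\pi(t),\pi(t+1)\}=\{p_i,p_j\}$. The multi-perimeter of a multi-tour $\pi$ of multiplicity $k$ is $\frac1{2k}\sum_{t\in\mathbb Z_{nk}}\rho(\pi(t),\pi(t+1))$. *)

theory Defs
  imports "HOL-Analysis.Analysis"
begin

text \<open>A graph is given by its vertex set and its set of edges, an edge being a two-element
  set of vertices. A tree has neither loops nor multiple edges, so simple graphs suffice.\<close>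

definition fin_graph :: "'v set \<Rightarrow> 'v set set \<Rightarrow> bool" where
  "fin_graph V E \<longleftrightarrow> finite V \<and> (\<forall>e\<in>E. e \<subseteq> V \<and> card e = 2)"

definition vertex_degree :: "'v set set \<Rightarrow> 'v \<Rightarrow> nat" where
  "vertex_degree E v = card {e \<in> E. v \<in> e}"

definition reachable :: "'v set set \<Rightarrow> 'v \<Rightarrow> 'v \<Rightarrow> bool" where
  "reachable E u v \<longleftrightarrow> (u, v) \<in> {(x, y). {x, y} \<in> E}\<^sup>*"

definition graph_components :: "'v set \<Rightarrow> 'v set set \<Rightarrow> 'v set set" where
  "graph_components V E = (\<lambda>u. {v \<in> V. reachable E u v}) ` V"

definition connected_graph :: "'v set \<Rightarrow> 'v set set \<Rightarrow> bool" where
  "connected_graph V E \<longleftrightarrow> V \<noteq> {} \<and> (\<forall>u\<in>V. \<forall>v\<in>V. reachable E u v)"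

definition is_graph_cycle :: "'v set set \<Rightarrow> 'v list \<Rightarrow> bool" where
  "is_graph_cycle E xs \<longleftrightarrow>
     3 \<le> length xs \<and> distinct xs \<and> successively (\<lambda>x y. {x, y} \<in> E) xs \<and> {last xs, hd xs} \<in> E"

definition fin_tree :: "'v set \<Rightarrow> 'v set set \<Rightarrow> bool" where
  "fin_tree V E \<longleftrightarrow> fin_graph V E \<and> connected_graph V E \<and> (\<nexists>xs. is_graph_cycle E xs)"

definition binary_tree :: "'v set \<Rightarrow> 'v set set \<Rightarrow> bool" where
  "binary_tree V E \<longleftrightarrow> fin_tree V E \<and> (\<forall>v\<in>V. vertex_degree E v = 1 \<or> vertex_degree E v = 3)"

definition tree_boundary :: "'v set \<Rightarrow> 'v set set \<Rightarrow> 'v set" where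
  "tree_boundary V E = {v \<in> V. vertex_degree E v = 1}"

definition connects :: "'v set \<Rightarrow> 'v set set \<Rightarrow> 'v set \<Rightarrow> bool" where
  "connects V E M \<longleftrightarrow> tree_boundary V E = M"

definition is_graph_path :: "'v set set \<Rightarrow> 'v \<Rightarrow> 'v \<Rightarrow> 'v list \<Rightarrow> bool" where
  "is_graph_path E u v xs \<longleftrightarrow>
     xs \<noteq> [] \<and> hd xs = u \<and> last xs = v \<and> distinct xs \<and> successively (\<lambda>x y. {x, y} \<in> E) xs"

definition path_edges :: "'v list \<Rightarrow> 'v set set" where
  "path_edges xs = (\<lambda>(x, y). {x, y}) ` set (zip xs (tl xs))"

text \<open>The edge set of the path joining \<open>u\<close> and \<open>v\<close>, meaningful when that path is unique,
  as it is in a tree.\<close>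

definition tree_path :: "'v set set \<Rightarrow> 'v \<Rightarrow> 'v \<Rightarrow> 'v set set" where
  "tree_path E u v = path_edges (THE xs. is_graph_path E u v xs)"

text \<open>The points of \<open>M\<close> are enumerated by a bijection \<open>p\<close> from a finite linearly ordered
  type \<open>'n\<close>, which stands for \<open>{1..n}\<close> with \<open>n = CARD('n)\<close>. Only the values of \<open>\<omega>\<close> on
  \<open>E\<close> matter.\<close>

definition gen_filling ::
  "('n::{finite,linorder} \<Rightarrow> 'v) \<Rightarrow> ('v \<Rightarrow> 'v \<Rightarrow> real) \<Rightarrow> 'v set set \<Rightarrow> ('v set \<Rightarrow> real) \<Rightarrow> bool" where
  "gen_filling p \<rho> E \<omega> \<longleftrightarrow>
     (\<forall>i j. i < j \<longrightarrow> \<rho> (p i) (p j) \<le> (\<Sum>e\<in>tree_path E (p i) (p j). \<omega> e))"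

text \<open>The infimum is taken in the extended reals, so that a real value of \<open>mpf_minus\<close> is
  never an artefact of the infimum of an empty or unbounded set of reals.\<close>

definition mpf_minus ::
  "('n::{finite,linorder} \<Rightarrow> 'v) \<Rightarrow> ('v \<Rightarrow> 'v \<Rightarrow> real) \<Rightarrow> 'v set set \<Rightarrow> ereal" where
  "mpf_minus p \<rho> E = (INF \<omega>\<in>{\<omega>. gen_filling p \<rho> E \<omega>}. ereal (\<Sum>e\<in>E. \<omega> e))"

definition edge_partition :: "'v set \<Rightarrow> 'v set set \<Rightarrow> 'v set \<Rightarrow> 'v set \<Rightarrow> 'v set set" where
  "edge_partition V E M e = (\<lambda>C. M \<inter> C) ` graph_components V (E - {e})"

definition separates :: "'v set \<Rightarrow> 'v set set \<Rightarrow> 'v set \<Rightarrow> 'v set \<Rightarrow> 'v \<Rightarrow> 'v \<Rightarrow> bool" where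
  "separates V E M e u v \<longleftrightarrow>
     (\<exists>A \<in> edge_partition V E M e. \<exists>B \<in> edge_partition V E M e. A \<noteq> B \<and> u \<in> A \<and> v \<in> B)"

text \<open>A vector with components indexed by \<open>i < j\<close> is represented by the strictly upper
  triangular matrix with these entries; this identifies the space of dimension
  \<open>n(n-1)/2\<close> with a coordinate subspace, which does not affect extreme points.\<close>

type_synonym 'n pair_vector = "((real, 'n) vec, 'n) vec"

definition Lambda_polyhedron ::
  "('n::{finite,linorder} \<Rightarrow> 'v) \<Rightarrow> 'v set \<Rightarrow> 'v set set \<Rightarrow> 'v set \<Rightarrow> 'n pair_vector set" where
  "Lambda_polyhedron p V E M = {x.
     (\<forall>i j. \<not> i < j \<longrightarrow> x $ i $ j = 0) \<and>
     (\<forall>i j. i < j \<longrightarrow> 0 \<le> x $ i $ j) \<and>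
     (\<forall>e\<in>E. (\<Sum>(i, j) | i < j \<and> separates V E M e (p i) (p j). x $ i $ j) = 1)}"

definition objective ::
  "('n::{finite,linorder} \<Rightarrow> 'v) \<Rightarrow> ('v \<Rightarrow> 'v \<Rightarrow> real) \<Rightarrow> 'n pair_vector \<Rightarrow> real" where
  "objective p \<rho> x = (\<Sum>(i, j) | i < j. \<rho> (p i) (p j) * x $ i $ j)"

text \<open>The residues modulo \<open>N = nk\<close> are represented by the numbers \<open>0, \<dots>, N - 1\<close>, with
  successor \<open>t \<mapsto> (t + 1) mod N\<close>; the values of \<open>\<pi>\<close> elsewhere are irrelevant.\<close>

definition multi_cyclic_order :: "'v set \<Rightarrow> nat \<Rightarrow> (nat \<Rightarrow> 'v) \<Rightarrow> bool" where
  "multi_cyclic_order M k \<pi> \<longleftrightarrow> 0 < k \<and>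
     (let N = card M * k in
       (\<forall>t<N. \<pi> t \<in> M) \<and>
       (\<forall>t<N. \<pi> t \<noteq> \<pi> ((t + 1) mod N)) \<and>
       (\<forall>x\<in>M. card {t. t < N \<and> \<pi> t = x} = k))"

definition multi_tour :: "'v set \<Rightarrow> 'v set set \<Rightarrow> 'v set \<Rightarrow> nat \<Rightarrow> (nat \<Rightarrow> 'v) \<Rightarrow> bool" where
  "multi_tour V E M k \<pi> \<longleftrightarrow> multi_cyclic_order M k \<pi> \<and>
     (let N = card M * k in
       \<exists>m>0. \<forall>e\<in>E. \<forall>A\<in>edge_partition V E M e.
         card {t. t < N \<and> \<pi> t \<in> A \<and> \<pi> ((t + 1) mod N) \<notin> A} = m)"

definition tour_vector ::
  "('n::{finite,linorder} \<Rightarrow> 'v) \<Rightarrow> 'v set \<Rightarrow> nat \<Rightarrow> (nat \<Rightarrow> 'v) \<Rightarrow> 'n pair_vector" where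
  "tour_vector p M k \<pi> = (let N = card M * k in
     \<chi> i j. if i < j
       then real (card {t. t < N \<and> {\<pi> t, \<pi> ((t + 1) mod N)} = {p i, p j}})
       else 0)"

definition multi_perimeter :: "('v \<Rightarrow> 'v \<Rightarrow> real) \<Rightarrow> 'v set \<Rightarrow> nat \<Rightarrow> (nat \<Rightarrow> 'v) \<Rightarrow> real" where
  "multi_perimeter \<rho> M k \<pi> = (let N = card M * k in
     1 / (2 * real k) * (\<Sum>t<N. \<rho> (\<pi> t) (\<pi> ((t + 1) mod N))))"

definition corresponding_multi_tour ::
  "('n::{finite,linorder} \<Rightarrow> 'v) \<Rightarrow> 'v set \<Rightarrow> 'v set set \<Rightarrow> 'v set \<Rightarrow> 'n pair_vector
    \<Rightarrow> nat \<Rightarrow> (nat \<Rightarrow> 'v) \<Rightarrow> bool" where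
  "corresponding_multi_tour p V E M x k \<pi> \<longleftrightarrow>
     multi_tour V E M k \<pi> \<and> x = (1 / (2 * real k)) *\<^sub>R tour_vector p M k \<pi>"

end

theory Submission
  imports Defs
begin

text \<open>
  The weight \<open>mpf_minus\<close> is the value of a linear program: minimise the total weight of a free
  vector \<open>\<omega>\<close> on the edges, subject to one inequality per pair of boundary points. The edges of
  the path between two boundary points are exactly those that separate them
  (\<open>tree_path_eq\<close>), so the dual program is to maximise the objective over the polyhedron
  \<open>\<Lambda>\<close>, and strong duality (\<open>lp_duality\<close>, a separation argument for a finitely generated
  cone) gives \<open>mpf_minus_eq\<close>. Since \<open>\<Lambda>\<close> is compact, the maximum is attained on a face and
  hence at an extreme point. That \<open>\<Lambda>\<close> is not empty is witnessed by a random walk: enter the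
  tree at a boundary point and at every inner vertex leave through one of the two other edges
  with equal probability (\<open>exists_unit_cut_weight\<close>).

  An extreme point \<open>x\<close> is the only point of \<open>\<Lambda>\<close> with its support. A good enough simultaneous
  rational approximation \<open>y\<close> of \<open>x\<close> satisfies the same integral constraints exactly and has
  its support inside that of \<open>x\<close>, so \<open>2x - y\<close> lies in \<open>\<Lambda>\<close> too, and \<open>x = y\<close> is rational
  (\<open>extreme_point_rational\<close>). Write \<open>x = c / k\<close> with \<open>c\<close> integral, and take \<open>c i j\<close> copies of
  every edge \<open>{i, j}\<close>. This multigraph on the boundary is connected, because three unit cuts
  around an inner vertex force weight \<open>1/2\<close> between any two of the three branches
  (\<open>unit_cut_connected\<close>). Hence there is a closed walk that traverses each copy once in each
  direction (\<open>exists_double_walk\<close>). As \<open>x\<close> has all cuts equal to \<open>1\<close>, the walk visits each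
  boundary point \<open>k\<close> times and leaves each side of each edge \<open>k\<close> times: it is a multi-tour of
  multiplicity \<open>k\<close> with vector \<open>2 c = 2 k x\<close>. Finally, summing distances along any multi-tour
  that corresponds to \<open>x\<close> gives the objective at \<open>x\<close> (\<open>tour_objective_eq_perimeter\<close>).
\<close>

section \<open>Linear programming duality\<close>

text \<open>The pairs \<open>(d, m)\<close> for which the conclusion holds form a cone \<open>K\<close> that contains the finitely many
  generators below. The cone they span is closed, so if it misses \<open>(d, m)\<close>, a hyperplane separates them. Its
  normal is \<open>(- x, t)\<close> with \<open>x\<close> in the nonnegative orthant, \<open>a e \<bullet> x = t\<close> for all \<open>e\<close>, and
  \<open>d \<bullet> x > t * m\<close>. If \<open>t > 0\<close>, then \<open>x / t\<close> violates the bound; if \<open>t = 0\<close>, then \<open>x\<close> is a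
  direction of recession along which \<open>d\<close> increases. The two hypotheses exclude these cases.\<close>

lemma lp_duality:
  fixes a :: "'e \<Rightarrow> 'a::euclidean_space" and d :: 'a and m :: real
  assumes fin: "finite E"
    and bound: "\<And>x. (\<forall>b\<in>Basis. 0 \<le> x \<bullet> b) \<Longrightarrow> (\<forall>e\<in>E. a e \<bullet> x = 1) \<Longrightarrow> d \<bullet> x \<le> m"
    and recession: "\<And>x. (\<forall>b\<in>Basis. 0 \<le> x \<bullet> b) \<Longrightarrow> (\<forall>e\<in>E. a e \<bullet> x = 0) \<Longrightarrow> d \<bullet> x \<le> 0"
  shows "\<exists>\<omega>. (\<forall>b\<in>Basis. d \<bullet> b \<le> (\<Sum>e\<in>E. \<omega> e * (a e \<bullet> b))) \<and> (\<Sum>e\<in>E. \<omega> e) \<le> m"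
proof -
  define gens where "gens = (\<lambda>e. (a e, 1::real)) ` E \<union> (\<lambda>e. (- a e, - 1)) ` E
      \<union> (\<lambda>b. (- b, 0)) ` Basis \<union> {(0, 1)}"
  define K where "K = {z::'a \<times> real. \<exists>\<omega>. (\<forall>b\<in>Basis. fst z \<bullet> b \<le> (\<Sum>e\<in>E. \<omega> e * (a e \<bullet> b)))
      \<and> (\<Sum>e\<in>E. \<omega> e) \<le> snd z}"
  have fing: "finite gens"
    using fin by (auto simp: gens_def)
  have "convex_cone hull gens \<subseteq> K"
  proof (rule hull_minimal)
    show "gens \<subseteq> K"
    proof
      fix z assume "z \<in> gens"
      then consider (pos) e where "e \<in> E" "z = (a e, 1)" | (neg) e where "e \<in> E" "z = (- a e, - 1)"
        | (coord) b where "b \<in> Basis" "z = (- b, 0)" | (slack) "z = (0, 1)"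
        by (auto simp: gens_def)
      then show "z \<in> K"
      proof cases
        case pos
        then show ?thesis
          using fin by (auto simp: K_def if_distrib[of "\<lambda>x. x * _"] cong: if_cong intro!: exI[of _ "\<lambda>f. if f = e then 1 else 0"])
      next
        case neg
        then show ?thesis
          using fin by (auto simp: K_def if_distrib[of "\<lambda>x. x * _"] cong: if_cong intro!: exI[of _ "\<lambda>f. if f = e then - 1 else 0"])
      next
        case coord
        then show ?thesis
          by (auto simp: K_def inner_Basis intro!: exI[of _ "\<lambda>f. 0"])
      next
        case slack
        then show ?thesis
          by (auto simp: K_def intro!: exI[of _ "\<lambda>f. 0"])
      qed
    qed
    show "convex_cone K"
    proof -
      have "x + y \<in> K" if xy: "x \<in> K" "y \<in> K" for x y
      proof -
        obtain \<omega> \<omega>' where w: "\<forall>b\<in>Basis. fst x \<bullet> b \<le> (\<Sum>e\<in>E. \<omega> e * (a e \<bullet> b))" "(\<Sum>e\<in>E. \<omega> e) \<le> snd x"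
          "\<forall>b\<in>Basis. fst y \<bullet> b \<le> (\<Sum>e\<in>E. \<omega>' e * (a e \<bullet> b))" "(\<Sum>e\<in>E. \<omega>' e) \<le> snd y"
          using xy by (auto simp: K_def)
        then show ?thesis
          by (auto simp: K_def inner_add_left distrib_right sum.distrib add_mono
              intro!: exI[of _ "\<lambda>e. \<omega> e + \<omega>' e"])
      qed
      moreover have "c *\<^sub>R x \<in> K" if x: "x \<in> K" and c: "0 \<le> c" for x c
      proof -
        obtain \<omega> where w: "\<forall>b\<in>Basis. fst x \<bullet> b \<le> (\<Sum>e\<in>E. \<omega> e * (a e \<bullet> b))" "(\<Sum>e\<in>E. \<omega> e) \<le> snd x"
          using x unfolding K_def by blast
        then show ?thesis using c
          by (auto simp: K_def sum_distrib_left[symmetric] mult.assoc mult_left_mono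
              intro!: exI[of _ "\<lambda>e. c * \<omega> e"])
      qed
      moreover have "0 \<in> K"
        by (auto simp: K_def intro!: exI[of _ "\<lambda>f. 0"])
      ultimately show ?thesis
        by (auto simp: convex_cone_iff)
    qed
  qed
  moreover have "(d, m) \<in> convex_cone hull gens"
  proof (rule ccontr)
    assume "(d, m) \<notin> convex_cone hull gens"
    then obtain y \<beta> where sep: "inner y (d, m) < \<beta>" "\<And>z. z \<in> convex_cone hull gens \<Longrightarrow> inner y z > \<beta>"
      using separating_hyperplane_closed_point[of "convex_cone hull gens" "(d, m)"]
        closed_convex_cone_hull[OF fing] convex_convex_cone_hull by blast
    have "\<beta> < 0"
      using sep(2)[OF convex_cone_hull_contains_0] by (simp add: inner_zero_right)
    \<comment> \<open>otherwise a multiple of the generator lies on the separating hyperplane itself\<close>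
    have nonneg: "0 \<le> inner y z" if "z \<in> gens" for z
    proof (rule ccontr)
      assume neg: "\<not> 0 \<le> inner y z"
      have "(\<beta> / inner y z) *\<^sub>R z \<in> convex_cone hull gens"
        using neg \<open>\<beta> < 0\<close> that by (intro convex_cone_hull_mul) (auto simp: hull_inc divide_nonpos_neg)
      from sep(2)[OF this] show False
        using neg by simp
    qed
    define x where "x = - fst y"
    define t where "t = snd y"
    have orthant: "\<forall>b\<in>Basis. 0 \<le> x \<bullet> b"
    proof
      fix b :: 'a assume "b \<in> Basis"
      then show "0 \<le> x \<bullet> b"
        using nonneg[of "(- b, 0)"] by (auto simp: gens_def inner_prod_def x_def inner_commute)
    qed
    have eqs: "a e \<bullet> x = t" if "e \<in> E" for e
      using nonneg[of "(a e, 1)"] nonneg[of "(- a e, - 1)"] that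
      by (auto simp: gens_def inner_prod_def x_def t_def inner_commute)
    have t0: "0 \<le> t"
      using nonneg[of "(0, 1)"] by (auto simp: gens_def inner_prod_def t_def)
    have gt: "d \<bullet> x > t * m"
      using sep(1) \<open>\<beta> < 0\<close> by (auto simp: inner_prod_def x_def t_def inner_commute)
    show False
    proof (cases "t = 0")
      case True
      then show ?thesis
        using recession[OF orthant] eqs gt by auto
    next
      case False
      then have "d \<bullet> (x /\<^sub>R t) \<le> m"
        using t0 orthant eqs by (intro bound) auto
      then show ?thesis
        using gt t0 False by (simp add: field_simps)
    qed
  qed
  ultimately have "(d, m) \<in> K"
    by blast
  then show ?thesis
    by (simp add: K_def)
qed

section \<open>Walks and paths in graphs\<close>

lemma reachable_refl [simp]: "reachable E u u"
  by (simp add: reachable_def)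

lemma reachable_trans: "reachable E u v \<Longrightarrow> reachable E v w \<Longrightarrow> reachable E u w"
  unfolding reachable_def by (rule rtrancl_trans)

lemma reachable_edge: "{u, v} \<in> E \<Longrightarrow> reachable E u v"
  unfolding reachable_def by auto

lemma reachable_sym: "reachable E u v \<Longrightarrow> reachable E v u"
  unfolding reachable_def
  by (rule symD[OF sym_rtrancl]) (auto simp: sym_def insert_commute)

lemma reachable_cong: "reachable E u v \<Longrightarrow> reachable E u w \<longleftrightarrow> reachable E v w"
  by (meson reachable_sym reachable_trans)

lemma reachable_induct [consumes 1, case_names refl step]:
  assumes "reachable E u v" and "P u"
    and "\<And>y z. reachable E u y \<Longrightarrow> {y, z} \<in> E \<Longrightarrow> P y \<Longrightarrow> P z"
  shows "P v"
  using assms(1) unfolding reachable_def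
  by (induction rule: rtrancl_induct) (use assms(2,3) in \<open>auto simp: reachable_def\<close>)

lemma walk_reachable:
  assumes "successively (\<lambda>x y. {x, y} \<in> E) xs" "xs \<noteq> []"
  shows "reachable E (hd xs) (last xs)"
  using assms
proof (induction xs)
  case (Cons x xs)
  then show ?case
    by (cases xs) (auto intro: reachable_trans[OF reachable_edge])
qed simp

text \<open>When the next vertex has been visited before, the path is cut back to that visit.\<close>

lemma reachable_imp_path:
  assumes "reachable E u v"
  shows "\<exists>xs. is_graph_path E u v xs"
  using assms
proof (induction rule: reachable_induct)
  case refl
  then show ?case
    by (auto simp: is_graph_path_def intro!: exI[of _ "[u]"])
next
  case (step y z)
  then obtain xs where xs: "is_graph_path E u y xs"
    by blast
  show ?case
  proof (cases "z \<in> set xs")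
    case True
    then obtain as bs where "xs = as @ z # bs"
      by (meson split_list)
    then have "is_graph_path E u z (as @ [z])"
      using xs by (auto simp: is_graph_path_def successively_append_iff hd_append split: if_splits)
    then show ?thesis ..
  next
    case False
    then have "is_graph_path E u z (xs @ [z])"
      using xs step by (auto simp: is_graph_path_def successively_append_iff)
    then show ?thesis ..
  qed
qed

lemma path_edges_Cons2 [simp]: "path_edges (x # y # zs) = insert {x, y} (path_edges (y # zs))"
  by (simp add: path_edges_def)

lemma path_edges_single [simp]: "path_edges [x] = {}" "path_edges [] = {}"
  by (simp_all add: path_edges_def)

lemma path_edges_subset_set: "e \<in> path_edges xs \<Longrightarrow> e \<subseteq> set xs"
  by (induction xs rule: induct_list012) auto

lemma path_edges_split:
  "e \<in> path_edges xs \<Longrightarrow> \<exists>ys a b zs. e = {a, b} \<and> xs = ys @ a # b # zs"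
proof (induction xs rule: induct_list012)
  case (3 x y zs)
  show ?case
  proof (cases "e = {x, y}")
    case True
    then have "x # y # zs = [] @ x # y # zs" by simp
    then show ?thesis
      using True by blast
  next
    case False
    then obtain ys a b zs' where "e = {a, b}" "y # zs = ys @ a # b # zs'"
      using 3 by auto
    then have "e = {a, b} \<and> x # y # zs = (x # ys) @ a # b # zs'"
      by simp
    then show ?thesis by blast
  qed
qed simp_all

lemma successively_path_edges: "successively (\<lambda>x y. {x, y} \<in> E) xs \<longleftrightarrow> path_edges xs \<subseteq> E"
  by (induction xs rule: induct_list012) auto

text \<open>The only edge of a path that contains its first vertex is the first edge, so the path can be
  rebuilt from its edge set step by step.\<close>

lemma path_determined_by_edges:
  assumes "distinct xs" "distinct ys" "xs \<noteq> []" "ys \<noteq> []" "hd xs = hd ys"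
    and "path_edges xs = path_edges ys"
  shows "xs = ys"
  using assms
proof (induction xs arbitrary: ys)
  case (Cons x xs)
  obtain ys' where ys: "ys = x # ys'"
    using Cons.prems(4,5) by (cases ys) auto
  have fresh: "{x, a} \<notin> path_edges xs" "{x, a} \<notin> path_edges ys'" for a
    using path_edges_subset_set[of "{x, a}" xs] path_edges_subset_set[of "{x, a}" ys']
      Cons.prems(1,2) ys by auto
  show ?case
  proof (cases xs)
    case Nil
    then have "path_edges (x # ys') = {}"
      using Cons.prems(6) ys by simp
    then show ?thesis
      using Nil ys by (cases ys') simp_all
  next
    case xs: (Cons y zs)
    then obtain y' zs' where ys': "ys' = y' # zs'"
      using Cons.prems(6) ys by (cases ys') simp_all
    have eq: "insert {x, y} (path_edges xs) = insert {x, y'} (path_edges ys')"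
      using Cons.prems(6) ys ys' xs by simp
    then have "{x, y} \<in> insert {x, y'} (path_edges ys')"
      by blast
    then have "y' = y"
      using fresh(2)[of y] by (auto simp: doubleton_eq_iff)
    then have "path_edges xs = path_edges ys'"
      using eq fresh by (metis insert_ident)
    then have "xs = ys'"
      using Cons.prems(1,2) xs ys ys' \<open>y' = y\<close> by (intro Cons.IH) simp_all
    then show ?thesis
      using ys by simp
  qed
qed simp

section \<open>Branches of a binary tree and the splits of its boundary\<close>

locale bin_tree =
  fixes V :: "'v set" and E :: "'v set set" and M :: "'v set"
  assumes binary: "binary_tree V E" and boundary: "connects V E M"
begin

lemma tree_properties: "fin_graph V E" "connected_graph V E" "\<not> is_graph_cycle E xs"
  using binary unfolding binary_tree_def fin_tree_def by blast+

lemma degrees: "v \<in> V \<Longrightarrow> vertex_degree E v = 1 \<or> vertex_degree E v = 3"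
  using binary unfolding binary_tree_def by blast

lemma finite_V: "finite V"
  using tree_properties(1) unfolding fin_graph_def by blast

lemma edge_subset: "e \<in> E \<Longrightarrow> e \<subseteq> V" and edge_card: "e \<in> E \<Longrightarrow> card e = 2"
  using tree_properties(1) unfolding fin_graph_def by blast+

lemma all_reachable: "u \<in> V \<Longrightarrow> v \<in> V \<Longrightarrow> reachable E u v" and V_nonempty: "V \<noteq> {}"
  using tree_properties(2) unfolding connected_graph_def by blast+

lemma finite_E: "finite E"
proof (rule finite_subset)
  show "E \<subseteq> Pow V"
    using edge_subset by blast
qed (simp add: finite_V)

lemma M_eq: "M = {v \<in> V. vertex_degree E v = 1}"
  using boundary unfolding connects_def tree_boundary_def by simp

lemma M_subset: "M \<subseteq> V"
  unfolding M_eq by blast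

lemma edge_neq: "{a, b} \<in> E \<Longrightarrow> a \<noteq> b"
  using edge_card[of "{a, b}"] by auto

lemma edge_vertices: "{a, b} \<in> E \<Longrightarrow> a \<in> V \<and> b \<in> V"
  using edge_subset[of "{a, b}"] by simp

lemma edge_obtain:
  assumes "e \<in> E" obtains a b where "e = {a, b}"
  using edge_card[OF assms] unfolding card_2_iff by blast

text \<open>Orienting the edge from \<open>a\<close> to \<open>b\<close> selects one of the two components that its deletion
  leaves; all sides of splits arise in this way.\<close>

definition branch :: "'v \<Rightarrow> 'v \<Rightarrow> 'v set" where
  "branch a b = {v \<in> V. reachable (E - {{a, b}}) b v}"

lemma endpoint_in_branch: "{a, b} \<in> E \<Longrightarrow> b \<in> branch a b"
  using edge_vertices by (simp add: branch_def)

text \<open>A path from \<open>b\<close> to \<open>a\<close> avoiding the edge between them would close up to a cycle.\<close>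

lemma not_in_branch:
  assumes ab: "{a, b} \<in> E"
  shows "a \<notin> branch a b"
proof
  assume "a \<in> branch a b"
  then obtain xs where xs: "is_graph_path (E - {{a, b}}) b a xs"
    using reachable_imp_path by (fastforce simp: branch_def)
  have "3 \<le> length xs"
    using xs edge_neq[OF ab]
    by (cases xs; cases "tl xs"; cases "tl (tl xs)") (auto simp: is_graph_path_def insert_commute)
  moreover have "successively (\<lambda>x y. {x, y} \<in> E) xs"
    using xs unfolding is_graph_path_def successively_path_edges by blast
  ultimately have "is_graph_cycle E xs"
    using xs ab by (auto simp: is_graph_cycle_def is_graph_path_def)
  then show False
    using tree_properties(3) by blast
qed

lemma branch_edge_closed:
  assumes "y \<in> branch a b" "{y, z} \<in> E" "{y, z} \<noteq> {a, b}"
  shows "z \<in> branch a b"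
proof -
  have "reachable (E - {{a, b}}) y z"
    using assms(2,3) by (intro reachable_edge) simp
  then show ?thesis
    using assms(1) edge_vertices[OF assms(2)] reachable_trans[of _ b y z] by (simp add: branch_def)
qed

lemma branches_disjoint:
  assumes ab: "{a, b} \<in> E"
  shows "branch a b \<inter> branch b a = {}"
proof -
  have "False" if "v \<in> branch a b" "v \<in> branch b a" for v
  proof -
    have "reachable (E - {{a, b}}) b a"
      using that reachable_cong[of "E - {{a, b}}" b v a] reachable_sym[of "E - {{a, b}}" a v]
      by (simp add: branch_def insert_commute)
    then show False
      using not_in_branch[OF ab] edge_vertices[OF ab] by (auto simp: branch_def)
  qed
  then show ?thesis by blast
qed

lemma branches_cover:
  assumes ab: "{a, b} \<in> E"
  shows "branch a b \<union> branch b a = V"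
proof -
  have "v \<in> branch a b \<union> branch b a" if "v \<in> V" for v
  proof -
    have "reachable E a v"
      using all_reachable edge_vertices[OF ab] that by blast
    then show ?thesis
    proof (induction rule: reachable_induct)
      case refl
      then show ?case
        using endpoint_in_branch[of b a] ab by (auto simp: insert_commute)
    next
      case (step y z)
      show ?case
      proof (cases "{y, z} = {a, b}")
        case True
        then show ?thesis
          using endpoint_in_branch[of b a] endpoint_in_branch[of a b] ab
          by (auto simp: insert_commute doubleton_eq_iff)
      next
        case False
        then show ?thesis
          using step branch_edge_closed[of y _ _ z] by (auto simp: insert_commute)
      qed
    qed
  qed
  then show ?thesis
    by (auto simp: branch_def)
qed

text \<open>A walk can leave \<open>branch a b\<close> only through the edge \<open>{a, b}\<close>, and a walk that stays
  within \<open>branch c d\<close> cannot use that edge, since it does not meet \<open>b\<close>.\<close>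

lemma branch_subset:
  assumes ab: "{a, b} \<in> E" and cd: "{c, d} \<in> E"
    and d: "d \<in> branch a b" and b: "b \<notin> branch c d"
  shows "branch c d \<subseteq> branch a b"
proof
  fix v assume "v \<in> branch c d"
  then have "reachable (E - {{c, d}}) d v"
    by (simp add: branch_def)
  then have "v \<in> branch a b \<and> v \<in> branch c d"
  proof (induction rule: reachable_induct)
    case refl
    then show ?case
      using d endpoint_in_branch[OF cd] by simp
  next
    case (step y z)
    then have z: "z \<in> branch c d"
      using branch_edge_closed[of y c d z] by auto
    then have "{y, z} \<noteq> {a, b}"
      using step b by (auto simp: doubleton_eq_iff)
    then show ?case
      using step z branch_edge_closed[of y a b z] by auto
  qed
  then show "v \<in> branch a b" ..
qed

text \<open>Descending the tree: the branches are nested along directed paths, which makes induction on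
  their size possible.\<close>

lemma child_branch_subset:
  assumes ab: "{a, b} \<in> E" and bc: "{b, c} \<in> E" and "c \<noteq> a"
  shows "branch b c \<subseteq> branch a b"
proof (rule branch_subset[OF ab bc])
  show "c \<in> branch a b"
    using branch_edge_closed[OF endpoint_in_branch[OF ab] bc] \<open>c \<noteq> a\<close> by (auto simp: doubleton_eq_iff)
  show "b \<notin> branch b c"
    using not_in_branch[OF bc] .
qed

lemma child_branches_disjoint:
  assumes bc: "{b, c} \<in> E" and bd: "{b, d} \<in> E" and "c \<noteq> d"
  shows "branch b c \<inter> branch b d = {}"
  using child_branch_subset[of d b c] branches_disjoint[of b d] bc bd \<open>c \<noteq> d\<close>
  by (auto simp: insert_commute)

lemma branch_cases:
  assumes ab: "{a, b} \<in> E" and v: "v \<in> branch a b"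
  shows "v = b \<or> (\<exists>c. {b, c} \<in> E \<and> c \<noteq> a \<and> v \<in> branch b c)"
proof -
  have "reachable (E - {{a, b}}) b v"
    using v by (simp add: branch_def)
  then show ?thesis
  proof (induction rule: reachable_induct)
    case (step y z)
    show ?case
    proof (cases "z = b")
      case True
      then show ?thesis ..
    next
      case False
      from step.IH show ?thesis
      proof
        assume "y = b"
        then have bz: "{b, z} \<in> E" "{b, z} \<noteq> {a, b}"
          using step.hyps(2) by simp_all
        then have "z \<noteq> a"
          by (metis insert_commute)
        then show ?thesis
          using bz(1) endpoint_in_branch[OF bz(1)] by blast
      next
        assume "\<exists>c. {b, c} \<in> E \<and> c \<noteq> a \<and> y \<in> branch b c"
        then obtain c where c: "{b, c} \<in> E" "c \<noteq> a" "y \<in> branch b c" by blast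
        then have "y \<noteq> b"
          using not_in_branch by blast
        then have "{y, z} \<noteq> {b, c}"
          using False by (simp add: doubleton_eq_iff)
        then have "z \<in> branch b c"
          using branch_edge_closed[OF c(3)] step.hyps(2) by simp
        then show ?thesis
          using c by blast
      qed
    qed
  qed simp
qed

definition sides :: "'v set set" where
  "sides = {M \<inter> branch a b | a b. {a, b} \<in> E}"

lemma edge_partition_eq:
  assumes ab: "{a, b} \<in> E"
  shows "edge_partition V E M {a, b} = {M \<inter> branch a b, M \<inter> branch b a}"
proof -
  have *: "{v \<in> V. reachable (E - {{a, b}}) u v} = branch a b" if "u \<in> branch a b" for u
    using that reachable_cong[of "E - {{a, b}}" b u] by (simp add: branch_def)
  have **: "{v \<in> V. reachable (E - {{a, b}}) u v} = branch b a" if "u \<in> branch b a" for u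
    using that reachable_cong[of "E - {{a, b}}" a u] by (simp add: branch_def insert_commute)
  have "graph_components V (E - {{a, b}}) = {branch a b, branch b a}"
  proof -
    have ne: "branch a b \<noteq> {}" "branch b a \<noteq> {}"
      using endpoint_in_branch[of a b] endpoint_in_branch[of b a] ab by (auto simp: insert_commute)
    define f where "f u = {v \<in> V. reachable (E - {{a, b}}) u v}" for u
    have "f ` branch a b = {branch a b}" "f ` branch b a = {branch b a}"
      using * ** ne by (auto simp: f_def image_iff)
    moreover have "graph_components V (E - {{a, b}}) = f ` (branch a b \<union> branch b a)"
      unfolding branches_cover[OF ab] by (simp add: graph_components_def f_def)
    ultimately show ?thesis
      by (simp add: image_Un insert_commute)
  qed
  then show ?thesis
    by (simp add: edge_partition_def)
qed

lemma complement_branch: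
  assumes "{a, b} \<in> E"
  shows "M - branch a b = M \<inter> branch b a"
  using branches_cover[OF assms] branches_disjoint[OF assms] M_subset by blast

lemma edge_partition_sides:
  assumes "e \<in> E" "A \<in> edge_partition V E M e"
  shows "A \<in> sides"
proof -
  obtain a b where e: "e = {a, b}"
    using edge_obtain[OF assms(1)] .
  then have "{a, b} \<in> E" "{b, a} \<in> E"
    using assms(1) by (auto simp: insert_commute)
  then show ?thesis
    using assms(2) unfolding e edge_partition_eq[OF \<open>{a, b} \<in> E\<close>] sides_def by blast
qed

lemma sides_subset: "S \<in> sides \<Longrightarrow> S \<subseteq> M"
  by (auto simp: sides_def)

lemma sides_complement: "S \<in> sides \<Longrightarrow> M - S \<in> sides"
proof -
  assume "S \<in> sides"
  then obtain a b where "{a, b} \<in> E" "S = M \<inter> branch a b"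
    by (auto simp: sides_def)
  moreover from this have "{b, a} \<in> E" "M - S = M \<inter> branch b a"
    using complement_branch[of a b] by (auto simp: insert_commute)
  ultimately show ?thesis
    unfolding sides_def by blast
qed

text \<open>Here the degrees enter: apart from \<open>{a, b}\<close>, the vertex \<open>b\<close> lies on no edge or on exactly two.\<close>

lemma branch_step:
  assumes ab: "{a, b} \<in> E"
  shows "(b \<in> M \<and> branch a b = {b}) \<or>
    (b \<notin> M \<and> (\<exists>c d. {b, c} \<in> E \<and> {b, d} \<in> E \<and> c \<noteq> d \<and> branch b c \<inter> branch b d = {} \<and>
       branch a b = insert b (branch b c \<union> branch b d)))"
proof -
  have bV: "b \<in> V"
    using edge_vertices[OF ab] by blast
  let ?N = "{e \<in> E. b \<in> e}"
  consider "vertex_degree E b = 1" | "vertex_degree E b = 3"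
    using degrees[OF bV] by blast
  then show ?thesis
  proof cases
    case 1
    then obtain e where "?N = {e}"
      unfolding vertex_degree_def by (rule card_1_singletonE)
    moreover have "{a, b} \<in> ?N"
      using ab by simp
    ultimately have N: "?N = {{a, b}}"
      by simp
    have "c = a" if "{b, c} \<in> E" for c
    proof -
      have "{b, c} \<in> ?N"
        using that by simp
      then show ?thesis
        unfolding N by (auto simp: doubleton_eq_iff)
    qed
    then have "branch a b = {b}"
      using branch_cases[OF ab] endpoint_in_branch[OF ab] by blast
    then show ?thesis
      using 1 bV by (simp add: M_eq)
  next
    case 3: 2
    have fin: "finite ?N"
      using finite_E by simp
    have "card (?N - {{a, b}}) = 2"
      using 3 ab fin by (simp add: vertex_degree_def card_Diff_singleton)
    then obtain e f where ef: "?N - {{a, b}} = {e, f}" "e \<noteq> f"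
      by (auto simp: card_2_iff)
    have other: "\<exists>c. g = {b, c}" if "g \<in> E" "b \<in> g" for g
      using that by (metis edge_obtain empty_iff insert_commute insert_iff)
    have "e \<in> E" "b \<in> e" "f \<in> E" "b \<in> f"
      using ef by blast+
    then obtain c d where c: "e = {b, c}" and d: "f = {b, d}"
      using other by meson
    have cd: "{b, c} \<in> E" "{b, d} \<in> E" "c \<noteq> a" "d \<noteq> a" "c \<noteq> d"
    proof -
      have "{b, c} \<in> ?N - {{a, b}}" "{b, d} \<in> ?N - {{a, b}}"
        unfolding ef(1) c d by blast+
      then show "{b, c} \<in> E" "{b, d} \<in> E" "c \<noteq> a" "d \<noteq> a"
        by (auto simp: insert_commute)
      show "c \<noteq> d"
        using ef(2) c d by blast
    qed
    have only: "g = c \<or> g = d" if "{b, g} \<in> E" "g \<noteq> a" for g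
    proof -
      have "{b, g} \<in> ?N - {{a, b}}"
        using that by (simp add: doubleton_eq_iff)
      then show ?thesis
        unfolding ef(1) c d by (auto simp: doubleton_eq_iff)
    qed
    have "branch a b = insert b (branch b c \<union> branch b d)"
      using branch_cases[OF ab] only endpoint_in_branch[OF ab] child_branch_subset[OF ab] cd
      by blast
    moreover have "b \<notin> M"
      using 3 by (simp add: M_eq)
    ultimately show ?thesis
      using cd child_branches_disjoint by blast
  qed
qed

lemma side_step:
  assumes ab: "{a, b} \<in> E"
  shows "M \<inter> branch a b = {b} \<or>
    (\<exists>c d. {b, c} \<in> E \<and> {b, d} \<in> E \<and> branch b c \<subset> branch a b \<and> branch b d \<subset> branch a b \<and>
       branch b c \<inter> branch b d = {} \<and>
       M \<inter> branch a b = (M \<inter> branch b c) \<union> (M \<inter> branch b d))"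
  using branch_step[OF ab]
proof (elim disjE conjE exE)
  fix c d
  assume *: "b \<notin> M" "{b, c} \<in> E" "{b, d} \<in> E" "branch b c \<inter> branch b d = {}"
    "branch a b = insert b (branch b c \<union> branch b d)"
  have "branch b c \<subset> branch a b" "branch b d \<subset> branch a b"
    using not_in_branch[OF *(2)] not_in_branch[OF *(3)] unfolding *(5) by blast+
  moreover have "M \<inter> branch a b = (M \<inter> branch b c) \<union> (M \<inter> branch b d)"
    using *(1) unfolding *(5) by blast
  ultimately show ?thesis
    using *(2-4) by blast
qed auto

lemma side_nonempty: "S \<in> sides \<Longrightarrow> S \<noteq> {}"
proof -
  have "M \<inter> branch a b \<noteq> {}" if "{a, b} \<in> E" for a b
    using that
  proof (induction "card (branch a b)" arbitrary: a b rule: less_induct)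
    case less
    have fin: "finite (branch a b)"
      using finite_V by (simp add: branch_def)
    from side_step[OF less.prems] show ?case
    proof (elim disjE exE conjE)
      fix c d
      assume "{b, c} \<in> E" "branch b c \<subset> branch a b"
        and split: "M \<inter> branch a b = (M \<inter> branch b c) \<union> (M \<inter> branch b d)"
      then have "M \<inter> branch b c \<noteq> {}"
        using less.hyps psubset_card_mono[OF fin] by simp
      then show ?thesis
        using split by simp
    qed simp
  qed
  then show "S \<in> sides \<Longrightarrow> S \<noteq> {}"
    unfolding sides_def by blast
qed

lemma side_split:
  assumes "S \<in> sides"
  shows "(\<exists>x. S = {x}) \<or> (\<exists>A B. A \<in> sides \<and> B \<in> sides \<and> A \<inter> B = {} \<and> S = A \<union> B)"
proof -
  obtain a b where ab: "{a, b} \<in> E" "S = M \<inter> branch a b"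
    using assms by (auto simp: sides_def)
  show ?thesis
    using side_step[OF ab(1)] unfolding ab(2) sides_def by blast
qed

lemma singleton_side:
  assumes "x \<in> M"
  shows "{x} \<in> sides"
proof -
  have "card {e \<in> E. x \<in> e} = 1" "x \<in> V"
    using assms unfolding M_eq vertex_degree_def by blast+
  then obtain e where "e \<in> E" "x \<in> e"
    by (metis (mono_tags, lifting) card_1_singletonE mem_Collect_eq singletonI)
  then obtain a where a: "{a, x} \<in> E"
    using edge_obtain[of e] by (metis insert_commute insertE singletonD)
  then have "M \<inter> branch a x = {x}"
    using branch_step[OF a] assms by auto
  then show ?thesis
    using a by (auto simp: sides_def)
qed

lemma edge_in_branch:
  assumes ab: "{a, b} \<in> E" and cd: "{c, d} \<in> E" and "{a, b} \<noteq> {c, d}"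
  shows "{c, d} \<subseteq> branch a b \<or> {c, d} \<subseteq> branch b a"
proof -
  have "c \<in> branch a b \<or> c \<in> branch b a"
    using branches_cover[OF ab] edge_vertices[OF cd] by blast
  moreover have "{c, d} \<noteq> {a, b}" "{c, d} \<noteq> {b, a}"
    using assms(3) by (simp_all add: insert_commute)
  ultimately show ?thesis
    using branch_edge_closed[OF _ cd] by blast
qed

text \<open>Of two distinct edges each lies on one side of the other, and so one of the four pairs of
  branches is nested.\<close>

lemma sides_compatible:
  assumes "S \<in> sides" "T \<in> sides"
  shows "S \<subseteq> T \<or> T \<subseteq> S \<or> S \<inter> T = {} \<or> S \<union> T = M"
proof -
  obtain a b where ab: "{a, b} \<in> E" "S = M \<inter> branch a b"
    using assms by (auto simp: sides_def)
  obtain c d where cd: "{c, d} \<in> E" "T = M \<inter> branch c d"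
    using assms by (auto simp: sides_def)
  have ba: "{b, a} \<in> E" and dc: "{d, c} \<in> E"
    using ab cd by (auto simp: insert_commute)
  show ?thesis
  proof (cases "{a, b} = {c, d}")
    case True
    then have "a = c \<and> b = d \<or> a = d \<and> b = c"
      by (simp add: doubleton_eq_iff)
    then show ?thesis
      using branches_disjoint[OF ab(1)] unfolding ab(2) cd(2) by blast
  next
    case False
    have nested: "branch c d \<subseteq> branch a b \<or> branch d c \<subseteq> branch a b"
      if ab: "{a, b} \<in> E" and cd: "{c, d} \<in> E" and sub: "{c, d} \<subseteq> branch a b" for a b c d
    proof (cases "b \<in> branch c d")
      case True
      then have "b \<notin> branch d c"
        using branches_disjoint[OF cd] by blast
      then show ?thesis
        using branch_subset[of a b d c] ab cd sub by (simp add: insert_commute)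
    next
      case False
      then show ?thesis
        using branch_subset[of a b c d] ab cd sub by simp
    qed
    have "branch c d \<subseteq> branch a b \<or> branch d c \<subseteq> branch a b \<or>
        branch c d \<subseteq> branch b a \<or> branch d c \<subseteq> branch b a"
      using edge_in_branch[OF ab(1) cd(1) False] nested[OF ab(1) cd(1)] nested[OF ba cd(1)] by blast
    moreover have "M - S = M \<inter> branch b a" "M - T = M \<inter> branch d c"
      using complement_branch[OF ab(1)] complement_branch[OF cd(1)] ab(2) cd(2) by blast+
    ultimately have "T \<subseteq> S \<or> M - T \<subseteq> S \<or> T \<subseteq> M - S \<or> M - T \<subseteq> M - S"
      using ab(2) cd(2) by blast
    moreover have "S \<subseteq> M" "T \<subseteq> M"
      using ab(2) cd(2) by blast+
    ultimately show ?thesis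
      by blast
  qed
qed

lemma separates_iff:
  assumes ab: "{a, b} \<in> E" and u: "u \<in> M" and v: "v \<in> M"
  shows "separates V E M {a, b} u v \<longleftrightarrow> (u \<in> branch a b) \<noteq> (v \<in> branch a b)"
proof -
  have "x \<in> branch b a \<longleftrightarrow> x \<notin> branch a b" if "x \<in> M" for x
    using branches_cover[OF ab] branches_disjoint[OF ab] that M_subset by blast
  then show ?thesis
    using u v unfolding separates_def edge_partition_eq[OF ab] by auto
qed

lemma separates_side:
  assumes "e \<in> E" "S \<in> edge_partition V E M e" "u \<in> M" "v \<in> M"
  shows "separates V E M e u v \<longleftrightarrow> (u \<in> S) \<noteq> (v \<in> S)"
proof -
  obtain a b where e: "e = {a, b}"
    using edge_obtain[OF assms(1)] by blast
  then have ab: "{a, b} \<in> E" using assms by simp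
  have "S = M \<inter> branch a b \<or> S = M - branch a b"
    using assms(2) edge_partition_eq[OF ab] complement_branch[OF ab] e by auto
  then show ?thesis
    using separates_iff[OF ab assms(3,4)] assms(3,4) e by auto
qed

text \<open>An edge of the path divides it into two pieces that avoid the edge, and so lie on its two
  sides; a path that avoids an edge stays on one side. As the right-hand side mentions only the ends,
  this also shows that the path is unique.\<close>

lemma path_edges_eq:
  assumes xs: "is_graph_path E u v xs" and u: "u \<in> M" and v: "v \<in> M"
  shows "path_edges xs = {e \<in> E. separates V E M e u v}"
proof (intro equalityI subsetI)
  fix e assume e: "e \<in> path_edges xs"
  then obtain ys zs a b where split: "e = {a, b}" "xs = ys @ a # b # zs"
    using path_edges_split by blast
  have eE: "e \<in> E"
    using e xs by (auto simp: is_graph_path_def successively_path_edges)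
  then have ab: "{a, b} \<in> E" using split by simp
  have d: "distinct (ys @ a # b # zs)" and w: "successively (\<lambda>x y. {x, y} \<in> E) (ys @ a # b # zs)"
    using xs split by (auto simp: is_graph_path_def)
  have avoid: "e \<notin> path_edges (ys @ [a])" "e \<notin> path_edges (b # zs)"
    using d path_edges_subset_set[of e "ys @ [a]"] path_edges_subset_set[of e "b # zs"] split by auto
  have "path_edges (ys @ [a]) \<subseteq> E" "path_edges (b # zs) \<subseteq> E"
    using w by (auto simp: successively_append_iff successively_Cons simp flip: successively_path_edges)
  then have "successively (\<lambda>x y. {x, y} \<in> E - {e}) (ys @ [a])" "successively (\<lambda>x y. {x, y} \<in> E - {e}) (b # zs)"
    using avoid unfolding successively_path_edges by blast+
  from this[THEN walk_reachable]
  have "reachable (E - {e}) (hd (ys @ [a])) a" "reachable (E - {e}) b (last (b # zs))"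
    by simp_all
  moreover have "hd (ys @ [a]) = u" "last (b # zs) = v"
    using xs split by (auto simp: is_graph_path_def hd_append)
  ultimately have "u \<in> branch b a" "v \<in> branch a b"
    using u v M_subset split(1) reachable_sym[of "E - {e}" u a] by (auto simp: branch_def insert_commute)
  then have "separates V E M {a, b} u v"
    using separates_iff[OF ab u v] branches_disjoint[OF ab] by blast
  then show "e \<in> {e \<in> E. separates V E M e u v}"
    using eE split by simp
next
  fix e assume "e \<in> {e \<in> E. separates V E M e u v}"
  then have e: "e \<in> E" "separates V E M e u v" by auto
  obtain a b where ab: "e = {a, b}"
    using edge_obtain[OF e(1)] .
  show "e \<in> path_edges xs"
  proof (rule ccontr)
    assume "e \<notin> path_edges xs"
    then have "successively (\<lambda>x y. {x, y} \<in> E - {e}) xs"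
      using xs unfolding is_graph_path_def successively_path_edges by auto
    then have r: "reachable (E - {e}) u v"
      using walk_reachable xs by (fastforce simp: is_graph_path_def)
    then have "(u \<in> branch a b) = (v \<in> branch a b)"
      using u v M_subset reachable_cong[OF r, of b] reachable_sym[of "E - {e}"] unfolding branch_def ab by blast
    then show False
      using separates_iff[of a b u v] e u v ab by auto
  qed
qed

lemma tree_path_eq:
  assumes u: "u \<in> M" and v: "v \<in> M"
  shows "tree_path E u v = {e \<in> E. separates V E M e u v}"
proof -
  obtain xs where xs: "is_graph_path E u v xs"
    using reachable_imp_path[OF all_reachable[of u v]] u v M_subset by blast
  have "(THE xs. is_graph_path E u v xs) = xs"
  proof (rule the_equality, rule xs)
    fix ys assume ys: "is_graph_path E u v ys"
    show "ys = xs"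
      using xs ys path_edges_eq[OF xs u v] path_edges_eq[OF ys u v]
      by (intro path_determined_by_edges[of ys xs]) (simp_all add: is_graph_path_def)
  qed
  then show ?thesis
    unfolding tree_path_def using path_edges_eq[OF xs u v] by simp
qed

end

section \<open>Families of splits with unit cuts\<close>

text \<open>All that is used of the tree from here on: the sides of its edges form a family of pairwise
  compatible sets, closed under complement, in which every side that is not a single point is
  divided by the two further edges at its end vertex.\<close>

locale binary_splits =
  fixes F :: "'n::finite set set"
  assumes compl: "S \<in> F \<Longrightarrow> - S \<in> F"
    and nonempty: "S \<in> F \<Longrightarrow> S \<noteq> {}"
    and split: "S \<in> F \<Longrightarrow> (\<exists>x. S = {x}) \<or> (\<exists>A B. A \<in> F \<and> B \<in> F \<and> A \<inter> B = {} \<and> S = A \<union> B)"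
    and singleton: "{x} \<in> F"
    and compatible: "S \<in> F \<Longrightarrow> T \<in> F \<Longrightarrow> S \<subseteq> T \<or> T \<subseteq> S \<or> S \<inter> T = {} \<or> S \<union> T = UNIV"
begin

lemma not_UNIV: "S \<in> F \<Longrightarrow> S \<noteq> UNIV"
  using compl[of S] nonempty[of "- S"] by auto

lemma split_induct [consumes 1, case_names singleton union]:
  assumes "S \<in> F"
    and "\<And>x. P {x}"
    and "\<And>A B. A \<in> F \<Longrightarrow> B \<in> F \<Longrightarrow> A \<union> B \<in> F \<Longrightarrow> A \<inter> B = {} \<Longrightarrow> P A \<Longrightarrow> P B \<Longrightarrow> P (A \<union> B)"
  shows "P S"
  using assms(1)
proof (induction "card S" arbitrary: S rule: less_induct)
  case less
  from split[OF less.prems] show ?case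
  proof (elim disjE exE conjE)
    fix x assume "S = {x}"
    then show ?thesis
      using assms(2) by simp
  next
    fix A B assume AB: "A \<in> F" "B \<in> F" "A \<inter> B = {}" "S = A \<union> B"
    have "A \<noteq> {}" "B \<noteq> {}"
      using nonempty AB(1,2) by blast+
    then have "A \<subset> S" "B \<subset> S"
      using AB(3,4) by blast+
    then have "card A < card S" "card B < card S"
      by (auto intro: psubset_card_mono)
    then have "P A" "P B"
      using less.hyps AB(1,2) by blast+
    then show ?thesis
      using assms(3)[of A B] AB less.prems by simp
  qed
qed

text \<open>The number of inner vertices that a walk from the edge of \<open>S\<close> to the leaf \<open>i\<close> in \<open>S\<close> passes,
  expressed by the edges that follow these vertices.\<close>

definition depth :: "'n set \<Rightarrow> 'n \<Rightarrow> nat" where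
  "depth S i = card {T \<in> F. i \<in> T \<and> T \<subset> S}"

text \<open>By compatibility, a side strictly inside \<open>A \<union> B\<close> cannot overlap both \<open>A\<close> and \<open>B\<close>.\<close>

lemma depth_union:
  assumes "A \<in> F" "B \<in> F" "A \<union> B \<in> F" "A \<inter> B = {}" "i \<in> A"
  shows "depth (A \<union> B) i = Suc (depth A i)"
proof -
  have "T \<subseteq> A" if T: "T \<in> F" "i \<in> T" "T \<subset> A \<union> B" for T
  proof -
    have "A \<union> B \<noteq> UNIV"
      using not_UNIV[OF assms(3)] .
    then have TA: "T \<subseteq> A \<or> A \<subseteq> T" and TB: "B \<subseteq> T \<or> T \<inter> B = {}"
      using compatible[OF T(1) assms(1)] compatible[OF T(1) assms(2)] T assms(4,5) by blast+
    then show ?thesis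
      using T(3) by blast
  qed
  moreover have "B \<noteq> {}"
    using nonempty[OF assms(2)] .
  ultimately have "{T \<in> F. i \<in> T \<and> T \<subset> A \<union> B} = insert A {T \<in> F. i \<in> T \<and> T \<subset> A}"
    using assms by blast
  then show ?thesis
    by (simp add: depth_def)
qed

text \<open>The random walk that enters \<open>S\<close> and chooses between the two onward edges with probability
  \<open>1/2\<close> each ends at the leaf \<open>i\<close> with probability \<open>(1/2) ^ depth S i\<close>.\<close>

lemma sum_depth:
  assumes "S \<in> F"
  shows "(\<Sum>i\<in>S. (1 / 2 :: real) ^ depth S i) = 1"
  using assms
proof (induction rule: split_induct)
  case (singleton x)
  have "{T \<in> F. x \<in> T \<and> T \<subset> {x}} = {}"
    by blast
  then have "depth {x} x = 0"
    unfolding depth_def by (simp only: card.empty)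
  then show ?case
    by simp
next
  case (union A B)
  have "depth (A \<union> B) i = Suc (depth B i)" if "i \<in> B" for i
    using depth_union[of B A i] union.hyps that by (simp add: Un_commute Int_commute)
  then show ?case
    using union by (simp add: sum.union_disjoint depth_union flip: sum_divide_distrib)
qed

lemma card_separating_sym:
  "card {T \<in> F. i \<in> T \<and> j \<notin> T} = card {T \<in> F. j \<in> T \<and> i \<notin> T}"
proof (rule bij_betw_same_card)
  show "bij_betw uminus {T \<in> F. i \<in> T \<and> j \<notin> T} {T \<in> F. j \<in> T \<and> i \<notin> T}"
    by (rule bij_betwI[where g = uminus]) (auto intro: compl)
qed

text \<open>The edges between \<open>i\<close> and \<open>j\<close> are those before, at and after the edge of \<open>S\<close>.\<close>

lemma card_separating:
  assumes S: "S \<in> F" and i: "i \<in> S" and j: "j \<notin> S"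
  shows "card {T \<in> F. i \<in> T \<and> j \<notin> T} = Suc (depth S i + depth (- S) j)"
proof -
  let ?A = "{T \<in> F. i \<in> T \<and> T \<subset> S}" and ?B = "{T \<in> F. j \<notin> T \<and> S \<subset> T}"
  have "{T \<in> F. i \<in> T \<and> j \<notin> T} = insert S (?A \<union> ?B)"
    using compatible[OF S] S i j by blast
  moreover have "S \<notin> ?A \<union> ?B" "?A \<inter> ?B = {}"
    by auto
  ultimately have "card {T \<in> F. i \<in> T \<and> j \<notin> T} = Suc (card ?A + card ?B)"
    by (simp add: card_Un_disjoint)
  moreover have "card ?B = depth (- S) j"
    unfolding depth_def
  proof (rule bij_betw_same_card)
    show "bij_betw uminus ?B {T \<in> F. j \<in> T \<and> T \<subset> - S}"
      by (rule bij_betwI[where g = uminus]) (auto intro: compl)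
  qed
  ultimately show ?thesis
    by (simp add: depth_def)
qed

text \<open>For \<open>i \<noteq> j\<close> the weight of \<open>(i, j)\<close> is the probability that the random walk started at \<open>i\<close> ends at \<open>j\<close>. By
  \<open>card_separating\<close> it factors across every edge between \<open>i\<close> and \<open>j\<close>, so that each cut is a product
  of two sums equal to \<open>1\<close>.\<close>

lemma exists_unit_cut_weight:
  "\<exists>c :: 'n \<Rightarrow> 'n \<Rightarrow> real. (\<forall>i j. 0 \<le> c i j) \<and> (\<forall>i j. c i j = c j i) \<and>
     (\<forall>S\<in>F. (\<Sum>i\<in>S. \<Sum>j\<in>- S. c i j) = 1)"
proof -
  define c where "c i j = 2 * (1 / 2 :: real) ^ card {T \<in> F. i \<in> T \<and> j \<notin> T}" for i j
  have "(\<Sum>i\<in>S. \<Sum>j\<in>- S. c i j) = 1" if S: "S \<in> F" for S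
  proof -
    have "(\<Sum>i\<in>S. \<Sum>j\<in>- S. c i j) =
        (\<Sum>i\<in>S. \<Sum>j\<in>- S. (1 / 2) ^ depth S i * (1 / 2) ^ depth (- S) j)"
      using S by (intro sum.cong refl) (simp add: c_def card_separating power_add)
    also have "\<dots> = (\<Sum>i\<in>S. (1 / 2) ^ depth S i) * (\<Sum>j\<in>- S. (1 / 2) ^ depth (- S) j)"
      by (simp add: sum_product)
    finally show ?thesis
      using sum_depth[OF S] sum_depth[OF compl[OF S]] by simp
  qed
  moreover have "c i j = c j i" "0 \<le> c i j" for i j
    using card_separating_sym[of i j] by (simp_all add: c_def)
  ultimately show ?thesis
    by blast
qed

text \<open>If a side \<open>P \<union> Q\<close> is divided into \<open>P\<close> and \<open>Q\<close>, the three unit cuts leave total weight \<open>1/2\<close>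
  between \<open>P\<close> and \<open>Q\<close>. So if \<open>P\<close> and \<open>Q\<close> each lie in \<open>A\<close> or in its complement, they lie on the same
  side of it. Inductively no side meets both \<open>A\<close> and its complement, and for the complement of a
  leaf in \<open>A\<close> this leaves only \<open>A = UNIV\<close>.\<close>

lemma unit_cut_connected:
  fixes c :: "'n \<Rightarrow> 'n \<Rightarrow> real"
  assumes sym: "\<And>i j. c i j = c j i"
    and cut: "\<And>S. S \<in> F \<Longrightarrow> (\<Sum>i\<in>S. \<Sum>j\<in>- S. c i j) = 1"
    and closed: "\<And>i j. i \<in> A \<Longrightarrow> j \<notin> A \<Longrightarrow> c i j = 0"
    and "A \<noteq> {}"
  shows "A = UNIV"
proof (rule ccontr)
  assume "A \<noteq> UNIV"
  define s where "s P Q = (\<Sum>i\<in>P. \<Sum>j\<in>Q. c i j)" for P Q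
  have s_sym: "s P Q = s Q P" for P Q
    unfolding s_def by (subst sum.swap) (simp add: sym)
  have s_Un: "s P (Q \<union> R) = s P Q + s P R" if "Q \<inter> R = {}" for P Q R
    using that by (simp add: s_def sum.union_disjoint sum.distrib)
  have s_cut: "s S (- S) = 1" if "S \<in> F" for S
    using cut[OF that] by (simp add: s_def)
  have pure: "S \<subseteq> A \<or> S \<subseteq> - A" if "S \<in> F" for S
    using that
  proof (induction rule: split_induct)
    case (union P Q)
    let ?R = "- (P \<union> Q)"
    have R: "- P = Q \<union> ?R" "- Q = P \<union> ?R" "Q \<inter> ?R = {}" "P \<inter> ?R = {}"
      using union.hyps(4) by blast+
    have "s P Q + s P ?R = 1" "s Q P + s Q ?R = 1"
      unfolding s_Un[OF R(3), symmetric] s_Un[OF R(4), symmetric] R(1)[symmetric] R(2)[symmetric]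
      using s_cut union.hyps(1,2) by blast+
    moreover have "s P ?R + s Q ?R = 1"
      using s_cut[OF union.hyps(3)] s_Un[OF union.hyps(4), of ?R] s_sym[of "P \<union> Q" ?R]
        s_sym[of P ?R] s_sym[of Q ?R] by argo
    ultimately have "s P Q \<noteq> 0"
      using s_sym[of P Q] by simp
    moreover have "s P Q = 0" if "P \<subseteq> A" "Q \<subseteq> - A"
      using that closed by (auto simp: s_def subset_iff intro!: sum.neutral)
    moreover have "s Q P = 0" if "P \<subseteq> - A" "Q \<subseteq> A"
      using that closed by (auto simp: s_def subset_iff intro!: sum.neutral)
    ultimately show ?case
      using union.IH s_sym[of P Q] by auto
  qed blast
  obtain a where a: "a \<in> A"
    using \<open>A \<noteq> {}\<close> by blast
  have "\<not> - {a} \<subseteq> A"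
    using a \<open>A \<noteq> UNIV\<close> by auto
  then have "- {a} \<subseteq> - A"
    using pure[OF compl[OF singleton]] by blast
  then have "s {a} (- {a}) = 0"
    using closed[OF a] by (auto simp: s_def intro!: sum.neutral)
  then show False
    using s_cut[OF singleton, of a] by simp
qed

end

section \<open>Closed walks through a doubled multigraph\<close>

definition arcs :: "'a list \<Rightarrow> ('a \<times> 'a) multiset" where
  "arcs xs = mset (zip xs (tl xs))"

lemma arcs_append: "arcs (as @ u # bs) = arcs (as @ [u]) + arcs (u # bs)"
proof (induction as)
  case (Cons a as)
  then show ?case
    by (cases as) (simp_all add: arcs_def)
qed (simp add: arcs_def)

lemma arcs_detour: "arcs (as @ u # v # u # bs) = arcs (as @ u # bs) + {#(u, v), (v, u)#}"
  unfolding arcs_append[of as u "v # u # bs"] arcs_append[of as u bs] by (simp add: arcs_def)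

lemma size_arcs: "size (arcs xs) = length xs - 1"
  by (simp add: arcs_def)

lemma arcs_vertices: "(i, j) \<in># arcs xs \<Longrightarrow> i \<in> set xs \<and> j \<in> set xs"
  by (cases xs) (auto simp: arcs_def dest: set_zip_leftD set_zip_rightD)

text \<open>Among the closed walks that use each arc at most \<open>c i j\<close> times and each edge equally often in
  both directions, take a longest one. If an edge \<open>{u, v}\<close> at a vertex \<open>u\<close> of the walk has a spare copy,
  the detour \<open>u, v, u\<close> prolongs the walk. So all edges at visited vertices are used up, and no edge
  leads from a visited to an unvisited vertex.\<close>

lemma exists_double_walk:
  fixes c :: "'a::finite \<Rightarrow> 'a \<Rightarrow> nat"
  assumes sym: "\<And>i j. c i j = c j i" and loopless: "\<And>i. c i i = 0"
    and connected: "\<And>A. A \<noteq> {} \<Longrightarrow> (\<And>i j. i \<in> A \<Longrightarrow> j \<notin> A \<Longrightarrow> c i j = 0) \<Longrightarrow> A = UNIV"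
  shows "\<exists>xs. xs \<noteq> [] \<and> hd xs = last xs \<and> (\<forall>i j. count (arcs xs) (i, j) = c i j)"
proof -
  define good where "good xs \<longleftrightarrow> xs \<noteq> [] \<and> hd xs = last xs \<and>
      (\<forall>i j. count (arcs xs) (i, j) \<le> c i j) \<and> (\<forall>i j. count (arcs xs) (i, j) = count (arcs xs) (j, i))"
    for xs :: "'a list"
  have "length xs \<le> Suc (\<Sum>(i, j)\<in>UNIV. c i j)" if "good xs" for xs
  proof -
    have "size (arcs xs) = (\<Sum>ij\<in>set_mset (arcs xs). count (arcs xs) ij)"
      by (simp add: size_multiset_overloaded_eq)
    also have "\<dots> \<le> (\<Sum>ij\<in>UNIV. count (arcs xs) ij)"
      by (rule sum_mono2) auto
    also have "\<dots> \<le> (\<Sum>(i, j)\<in>UNIV. c i j)"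
      using that by (intro sum_mono) (auto simp: good_def)
    finally show ?thesis
      by (simp add: size_arcs)
  qed
  moreover have "good [undefined]"
    by (simp add: good_def arcs_def)
  ultimately obtain xs where xs: "good xs" and maximal: "\<And>ys. good ys \<Longrightarrow> length ys \<le> length xs"
    using ex_has_greatest_nat[of good "[undefined]" length] by (metis le_imp_less_Suc)
  have saturated: "count (arcs xs) (u, v) = c u v" if u: "u \<in> set xs" for u v
  proof (rule ccontr)
    assume "count (arcs xs) (u, v) \<noteq> c u v"
    then have less: "count (arcs xs) (u, v) < c u v"
      using xs by (auto simp: good_def le_neq_implies_less)
    then have "u \<noteq> v"
      using loopless by force
    obtain as bs where split: "xs = as @ u # bs"
      using u by (meson split_list)
    let ?ys = "as @ u # v # u # bs"
    have count: "count (arcs ?ys) (i, j) = count (arcs xs) (i, j) + (if (i, j) = (u, v) \<or> (i, j) = (v, u) then 1 else 0)" for i j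
    proof -
      have "count {#(u, v), (v, u)#} (i, j) = (if (i, j) = (u, v) \<or> (i, j) = (v, u) then 1 else 0)"
        using \<open>u \<noteq> v\<close> by auto
      then show ?thesis
        unfolding split by (simp only: arcs_detour[of as u v bs] count_union)
    qed
    have less': "count (arcs xs) (v, u) < c v u"
      using less xs sym[of u v] unfolding good_def by metis
    have "count (arcs ?ys) (i, j) \<le> c i j" for i j
      using xs less less' unfolding count good_def by (auto simp: Suc_le_eq)
    moreover have "count (arcs ?ys) (i, j) = count (arcs ?ys) (j, i)" for i j
      using xs unfolding count good_def by auto
    moreover have "hd ?ys = last ?ys"
      using xs unfolding good_def split by (auto simp: hd_append split: if_splits)
    ultimately have "good ?ys"
      by (simp add: good_def)
    from maximal[OF this] show False
      by (simp add: split)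
  qed
  have "set xs = UNIV"
  proof (rule connected)
    show "set xs \<noteq> {}"
      using xs by (simp add: good_def)
    show "c i j = 0" if "i \<in> set xs" "j \<notin> set xs" for i j
      using saturated[OF that(1), of j] that(2) arcs_vertices[of i j xs]
      by (metis count_inI)
  qed
  then show ?thesis
    using saturated xs by (auto simp: good_def)
qed

lemma exists_closed_sequence:
  fixes c :: "'a::finite \<Rightarrow> 'a \<Rightarrow> nat"
  assumes sym: "\<And>i j. c i j = c j i" and loopless: "\<And>i. c i i = 0"
    and connected: "\<And>A. A \<noteq> {} \<Longrightarrow> (\<And>i j. i \<in> A \<Longrightarrow> j \<notin> A \<Longrightarrow> c i j = 0) \<Longrightarrow> A = UNIV"
  shows "\<exists>N f. f N = f 0 \<and>
    (\<forall>R. card {t. t < N \<and> (f t, f (Suc t)) \<in> R} = (\<Sum>(i, j)\<in>R. c i j))"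
proof -
  obtain xs where xs: "xs \<noteq> []" "hd xs = last xs" and c: "\<And>i j. count (arcs xs) (i, j) = c i j"
    using exists_double_walk[of c] assms by metis
  define N where "N = length xs - 1"
  have len: "length (zip xs (tl xs)) = N"
    by (simp add: N_def)
  have nth: "zip xs (tl xs) ! t = (xs ! t, xs ! Suc t)" if "t < N" for t
    using that by (simp add: N_def nth_tl)
  have "card {t. t < N \<and> (xs ! t, xs ! Suc t) \<in> R} = (\<Sum>(i, j)\<in>R. c i j)" for R
  proof -
    have "{t. t < N \<and> (xs ! t, xs ! Suc t) \<in> R} =
        {t. t < length (zip xs (tl xs)) \<and> zip xs (tl xs) ! t \<in> R}"
      using nth len by auto
    then have "card {t. t < N \<and> (xs ! t, xs ! Suc t) \<in> R} = size (filter_mset (\<lambda>a. a \<in> R) (arcs xs))"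
      by (simp add: arcs_def length_filter_conv_card flip: mset_filter)
    also have "\<dots> = (\<Sum>a\<in>R. count (arcs xs) a)"
    proof -
      have "size (filter_mset (\<lambda>a. a \<in> R) (arcs xs)) =
          (\<Sum>a\<in>set_mset (filter_mset (\<lambda>a. a \<in> R) (arcs xs)). count (filter_mset (\<lambda>a. a \<in> R) (arcs xs)) a)"
        by (simp add: size_multiset_overloaded_eq)
      also have "\<dots> = (\<Sum>a\<in>R. count (filter_mset (\<lambda>a. a \<in> R) (arcs xs)) a)"
        by (rule sum.mono_neutral_left) (auto simp: count_eq_zero_iff)
      finally show ?thesis
        by simp
    qed
    finally show ?thesis
      by (simp add: c case_prod_beta flip: c)
  qed
  moreover have "xs ! N = xs ! 0"
    using xs by (simp add: N_def hd_conv_nth last_conv_nth)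
  ultimately show ?thesis
    by blast
qed

section \<open>The polyhedron and its extreme points\<close>

lemma simultaneous_approximation:
  fixes \<theta> :: "'a::finite \<Rightarrow> real"
  assumes "0 < N"
  obtains q :: nat and P :: "'a \<Rightarrow> int"
  where "0 < q" "\<And>a. \<bar>real q * \<theta> a - of_int (P a)\<bar> < 1 / real N"
proof -
  obtain h where h: "bij_betw h {0..<CARD('a)} (UNIV :: 'a set)"
    using ex_bij_betw_nat_finite[of "UNIV :: 'a set"] by auto
  obtain q P where q: "0 < q" "\<And>t. t < CARD('a) \<Longrightarrow> \<bar>of_int q * \<theta> (h t) - of_int (P t)\<bar> < 1 / real N"
    using Dirichlet_approx_simult[OF assms, of "CARD('a)" "\<lambda>t. \<theta> (h t)"] by metis
  define g where "g = inv_into {0..<CARD('a)} h"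
  have g: "g a < CARD('a)" "h (g a) = a" for a
  proof -
    have a: "a \<in> h ` {0..<CARD('a)}"
      using h by (simp add: bij_betw_def)
    from inv_into_into[OF a] show "g a < CARD('a)"
      by (simp add: g_def)
    from f_inv_into_f[OF a] show "h (g a) = a"
      by (simp add: g_def)
  qed
  have "\<bar>real (nat q) * \<theta> a - of_int (P (g a))\<bar> < 1 / real N" for a
    using q(2)[OF g(1)[of a]] g(2)[of a] q(1) by simp
  then show thesis
    using that[of "nat q" "P \<circ> g"] q(1) by simp
qed

text \<open>Passing from the strictly upper triangular matrix to its symmetrisation turns the constraint
  of a split into a sum over a product, to which the results on splits apply.\<close>

lemma cut_sum_upper:
  fixes x :: "('n::{finite,linorder}) pair_vector"
  assumes upper: "\<And>i j. \<not> i < j \<Longrightarrow> x $ i $ j = 0"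
  shows "(\<Sum>(i, j) | i < j \<and> (i \<in> S) \<noteq> (j \<in> S). x $ i $ j) = (\<Sum>i\<in>S. \<Sum>j\<in>- S. x $ i $ j + x $ j $ i)"
proof -
  have "(\<Sum>(i, j) | i < j \<and> (i \<in> S) \<noteq> (j \<in> S). x $ i $ j) = (\<Sum>(i, j)\<in>S \<times> (- S) \<union> (- S) \<times> S. x $ i $ j)"
    by (rule sum.mono_neutral_left) (auto intro: upper)
  also have "\<dots> = (\<Sum>(i, j)\<in>S \<times> (- S). x $ i $ j) + (\<Sum>(i, j)\<in>(- S) \<times> S. x $ i $ j)"
    by (rule sum.union_disjoint) auto
  also have "(\<Sum>(i, j)\<in>(- S) \<times> S. x $ i $ j) = (\<Sum>i\<in>S. \<Sum>j\<in>- S. x $ j $ i)"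
    by (subst sum.swap) (simp add: sum.cartesian_product)
  finally show ?thesis
    by (simp add: sum.distrib sum.cartesian_product)
qed

locale indexed_tree = bin_tree V E M for V :: "'v set" and E M +
  fixes p :: "'n::{finite,linorder} \<Rightarrow> 'v"
  assumes bij: "bij_betw p UNIV M"
begin

lemma p_in [simp]: "p i \<in> M"
  using bij by (auto simp: bij_betw_def)

lemma p_eq_iff [simp]: "p i = p j \<longleftrightarrow> i = j"
  using bij by (auto simp: bij_betw_def inj_eq)

lemma p_obtain:
  assumes "u \<in> M" obtains i where "u = p i"
  using bij assms by (auto simp: bij_betw_def)

lemma card_M: "card M = CARD('n)"
  using bij_betw_same_card[OF bij] by simp

definition splits :: "'n set set" where
  "splits = (\<lambda>S. p -` S) ` sides"

lemma splits_iff: "S \<in> splits \<longleftrightarrow> (\<exists>e\<in>E. \<exists>A\<in>edge_partition V E M e. S = p -` A)"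
proof
  assume "S \<in> splits"
  then obtain a b where "{a, b} \<in> E" "S = p -` (M \<inter> branch a b)"
    by (auto simp: splits_def sides_def)
  then show "\<exists>e\<in>E. \<exists>A\<in>edge_partition V E M e. S = p -` A"
    using edge_partition_eq by blast
next
  assume "\<exists>e\<in>E. \<exists>A\<in>edge_partition V E M e. S = p -` A"
  then show "S \<in> splits"
    using edge_partition_sides by (auto simp: splits_def)
qed

lemma edge_partition_nonempty: "e \<in> E \<Longrightarrow> edge_partition V E M e \<noteq> {}"
  using edge_obtain[of e] edge_partition_eq by (metis insert_not_empty)

lemma p_image_vimage: "S \<subseteq> M \<Longrightarrow> p ` (p -` S) = S"
  using bij by (auto simp: bij_betw_def)

sublocale binary_splits splits
proof
  fix S assume "S \<in> splits"
  then obtain A where A: "A \<in> sides" "S = p -` A"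
    by (auto simp: splits_def)
  have AM: "A \<subseteq> M"
    using sides_subset[OF A(1)] .
  have "- S = p -` (M - A)"
    using A by auto
  then show "- S \<in> splits"
    using sides_complement[OF A(1)] by (auto simp: splits_def)
  show "S \<noteq> {}"
    using side_nonempty[OF A(1)] AM A(2) p_image_vimage by blast
  from side_split[OF A(1)]
  show "(\<exists>x. S = {x}) \<or> (\<exists>A B. A \<in> splits \<and> B \<in> splits \<and> A \<inter> B = {} \<and> S = A \<union> B)"
  proof (elim disjE exE conjE)
    fix x assume x: "A = {x}"
    then obtain i where "x = p i"
      using AM p_obtain by blast
    then have "S = {i}"
      using A(2) x by auto
    then show ?thesis
      by blast
  next
    fix B C assume BC: "B \<in> sides" "C \<in> sides" "B \<inter> C = {}" "A = B \<union> C"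
    have "p -` B \<in> splits" "p -` C \<in> splits" "p -` B \<inter> p -` C = {}" "S = p -` B \<union> p -` C"
      using BC A(2) by (auto simp: splits_def)
    then show ?thesis
      by blast
  qed
  fix T assume "T \<in> splits"
  then obtain B where B: "B \<in> sides" "T = p -` B"
    by (auto simp: splits_def)
  have BM: "B \<subseteq> M"
    using sides_subset[OF B(1)] .
  from sides_compatible[OF A(1) B(1)]
  show "S \<subseteq> T \<or> T \<subseteq> S \<or> S \<inter> T = {} \<or> S \<union> T = UNIV"
  proof (elim disjE)
    assume "A \<union> B = M"
    then have "S \<union> T = UNIV"
      using A(2) B(2) p_in by auto
    then show ?thesis by blast
  qed (use A(2) B(2) in blast)+
next
  fix x
  have "{x} = p -` {p x}"
    by auto
  then show "{x} \<in> splits"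
    using singleton_side[of "p x"] by (auto simp: splits_def)
qed

lemma separates_split:
  assumes "e \<in> E" "A \<in> edge_partition V E M e"
  shows "separates V E M e (p i) (p j) \<longleftrightarrow> (i \<in> p -` A) \<noteq> (j \<in> p -` A)"
  using separates_side[OF assms p_in p_in] by simp

abbreviation \<Lambda> :: "'n pair_vector set" where
  "\<Lambda> \<equiv> Lambda_polyhedron p V E M"

definition crossing :: "'v set \<Rightarrow> ('n \<times> 'n) set" where
  "crossing e = {(i, j). i < j \<and> separates V E M e (p i) (p j)}"

lemma Lambda_crossing:
  "x \<in> \<Lambda> \<longleftrightarrow> (\<forall>i j. \<not> i < j \<longrightarrow> x $ i $ j = 0) \<and> (\<forall>i j. 0 \<le> x $ i $ j) \<and>
     (\<forall>e\<in>E. (\<Sum>(i, j)\<in>crossing e. x $ i $ j) = 1)"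
proof -
  have "(\<forall>i j. i < j \<longrightarrow> 0 \<le> x $ i $ j) \<longleftrightarrow> (\<forall>i j. 0 \<le> x $ i $ j)"
    if "\<forall>i j. \<not> i < j \<longrightarrow> x $ i $ j = 0"
    using that by (metis order_refl)
  then show ?thesis
    unfolding Lambda_polyhedron_def crossing_def mem_Collect_eq by blast
qed

lemma Lambda_cut:
  "x \<in> \<Lambda> \<longleftrightarrow> (\<forall>i j. \<not> i < j \<longrightarrow> x $ i $ j = 0) \<and> (\<forall>i j. 0 \<le> x $ i $ j) \<and>
     (\<forall>S\<in>splits. (\<Sum>i\<in>S. \<Sum>j\<in>- S. x $ i $ j + x $ j $ i) = 1)"
proof -
  have eq: "(\<Sum>(i, j)\<in>crossing e. x $ i $ j) = (\<Sum>i\<in>p -` A. \<Sum>j\<in>- (p -` A). x $ i $ j + x $ j $ i)"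
    if "e \<in> E" "A \<in> edge_partition V E M e" "\<forall>i j. \<not> i < j \<longrightarrow> x $ i $ j = 0" for e A
    unfolding crossing_def separates_split[OF that(1,2)] using that(3) by (intro cut_sum_upper) blast
  have "(\<forall>e\<in>E. (\<Sum>(i, j)\<in>crossing e. x $ i $ j) = 1) \<longleftrightarrow>
      (\<forall>S\<in>splits. (\<Sum>i\<in>S. \<Sum>j\<in>- S. x $ i $ j + x $ j $ i) = 1)"
    if upper: "\<forall>i j. \<not> i < j \<longrightarrow> x $ i $ j = 0"
  proof (intro iffI ballI)
    fix S assume L: "\<forall>e\<in>E. (\<Sum>(i, j)\<in>crossing e. x $ i $ j) = 1" and "S \<in> splits"
    then obtain e A where eA: "e \<in> E" "A \<in> edge_partition V E M e" "S = p -` A"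
      unfolding splits_iff by blast
    then show "(\<Sum>i\<in>S. \<Sum>j\<in>- S. x $ i $ j + x $ j $ i) = 1"
      using eq[OF eA(1,2) upper] L by simp
  next
    fix e assume R: "\<forall>S\<in>splits. (\<Sum>i\<in>S. \<Sum>j\<in>- S. x $ i $ j + x $ j $ i) = 1" and e: "e \<in> E"
    obtain A where A: "A \<in> edge_partition V E M e"
      using edge_partition_nonempty[OF e] by blast
    then have "p -` A \<in> splits"
      using e unfolding splits_iff by blast
    then show "(\<Sum>(i, j)\<in>crossing e. x $ i $ j) = 1"
      using eq[OF e A upper] R by simp
  qed
  then show ?thesis
    unfolding Lambda_crossing by blast
qed

lemma Lambda_nonempty: "\<Lambda> \<noteq> {}"
proof -
  obtain c :: "'n \<Rightarrow> 'n \<Rightarrow> real" where c: "\<And>i j. 0 \<le> c i j" "\<And>i j. c i j = c j i"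
    "\<And>S. S \<in> splits \<Longrightarrow> (\<Sum>i\<in>S. \<Sum>j\<in>- S. c i j) = 1"
    using exists_unit_cut_weight by metis
  define x :: "'n pair_vector" where "x = (\<chi> i j. if i < j then c i j else 0)"
  have "(\<Sum>i\<in>S. \<Sum>j\<in>- S. x $ i $ j + x $ j $ i) = (\<Sum>i\<in>S. \<Sum>j\<in>- S. c i j)" for S
  proof (intro sum.cong refl)
    fix i j assume "i \<in> S" "j \<in> - S"
    then have "i < j \<or> j < i"
      by (metis ComplD linorder_less_linear)
    then show "x $ i $ j + x $ j $ i = c i j"
      using c(2)[of i j] by (auto simp: x_def)
  qed
  then have "x \<in> \<Lambda>"
    unfolding Lambda_cut using c by (simp add: x_def)
  then show ?thesis
    by blast
qed

lemma Lambda_row_sum: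
  assumes "x \<in> \<Lambda>"
  shows "(\<Sum>j\<in>- {i}. x $ i $ j + x $ j $ i) = 1"
  using assms singleton[of i] unfolding Lambda_cut by fastforce

lemma Lambda_le_1:
  assumes "x \<in> \<Lambda>"
  shows "\<bar>x $ i $ j\<bar> \<le> 1"
proof (cases "i < j")
  case True
  have nonneg: "\<And>i j. 0 \<le> x $ i $ j"
    using assms unfolding Lambda_cut by blast
  have "x $ i $ j + x $ j $ i \<le> (\<Sum>j\<in>- {i}. x $ i $ j + x $ j $ i)"
    using True nonneg by (intro member_le_sum) auto
  then show ?thesis
    using Lambda_row_sum[OF assms] nonneg[of i j] nonneg[of j i] by simp
next
  case False
  then have "x $ i $ j = 0"
    using assms unfolding Lambda_cut by blast
  then show ?thesis by simp
qed

lemma convex_Lambda: "convex \<Lambda>"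
proof (rule convexI)
  fix x y :: "'n pair_vector" and u v :: real
  assume x: "x \<in> \<Lambda>" and y: "y \<in> \<Lambda>" and uv: "0 \<le> u" "0 \<le> v" "u + v = 1"
  have "(\<Sum>(i, j)\<in>crossing e. (u *\<^sub>R x + v *\<^sub>R y) $ i $ j) = 1" if "e \<in> E" for e
  proof -
    have "(\<Sum>(i, j)\<in>crossing e. (u *\<^sub>R x + v *\<^sub>R y) $ i $ j) =
        u * (\<Sum>(i, j)\<in>crossing e. x $ i $ j) + v * (\<Sum>(i, j)\<in>crossing e. y $ i $ j)"
      by (simp add: case_prod_beta sum.distrib sum_distrib_left)
    then show ?thesis
      using x y that uv(3) unfolding Lambda_crossing by simp
  qed
  moreover have "(u *\<^sub>R x + v *\<^sub>R y) $ i $ j = 0" if "\<not> i < j" for i j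
    using x y that unfolding Lambda_crossing by simp
  moreover have "0 \<le> (u *\<^sub>R x + v *\<^sub>R y) $ i $ j" for i j
    using x y uv(1,2) unfolding Lambda_crossing by simp
  ultimately show "u *\<^sub>R x + v *\<^sub>R y \<in> \<Lambda>"
    unfolding Lambda_crossing by blast
qed

lemma compact_Lambda: "compact \<Lambda>"
proof -
  have "closed \<Lambda>"
    unfolding Lambda_polyhedron_def case_prod_beta Ball_def
    by (intro closed_Collect_conj closed_Collect_all closed_Collect_imp
        closed_Collect_eq closed_Collect_le continuous_intros open_Collect_const)
  moreover have "norm x \<le> real CARD('n) * real CARD('n)" if "x \<in> \<Lambda>" for x
  proof -
    have "norm x \<le> (\<Sum>i\<in>UNIV. norm (x $ i))"
      unfolding norm_vec_def by (rule L2_set_le_sum) simp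
    also have "\<dots> \<le> (\<Sum>i\<in>(UNIV :: 'n set). \<Sum>j\<in>(UNIV :: 'n set). \<bar>x $ i $ j\<bar>)"
      by (intro sum_mono norm_le_l1_cart)
    also have "\<dots> \<le> (\<Sum>i\<in>(UNIV :: 'n set). \<Sum>j\<in>(UNIV :: 'n set). 1)"
      by (intro sum_mono Lambda_le_1 that)
    finally show ?thesis by simp
  qed
  ultimately show ?thesis
    unfolding compact_eq_bounded_closed bounded_iff by blast
qed

text \<open>Choose \<open>N\<close> larger than the number of coordinates and than the inverse of every nonzero
  coordinate, and let \<open>q\<close> be such that \<open>q * x\<close> is within \<open>1 / N\<close> of the integral vector \<open>P\<close>. Then \<open>P\<close>
  vanishes where \<open>x\<close> does, and each constraint sum of \<open>P\<close> is an integer at distance less than \<open>1\<close> from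
  \<open>q\<close>, hence equal to \<open>q\<close>. So \<open>y = P / q\<close> and its reflection \<open>z = 2 x - y\<close> both lie in \<open>\<Lambda>\<close>, and
  \<open>x\<close>, being their midpoint and extreme, equals \<open>y\<close>.\<close>

lemma extreme_point_rational:
  assumes ext: "x extreme_point_of \<Lambda>"
  obtains k :: nat and c :: "'n \<Rightarrow> 'n \<Rightarrow> nat" where "0 < k" "\<And>i j. real k * x $ i $ j = real (c i j)"
proof -
  have x: "x \<in> \<Lambda>"
    using ext by (simp add: extreme_point_of_def)
  have upper: "\<And>i j. \<not> i < j \<Longrightarrow> x $ i $ j = 0" and nonneg: "\<And>i j. 0 \<le> x $ i $ j"
    and cross: "\<And>e. e \<in> E \<Longrightarrow> (\<Sum>(i, j)\<in>crossing e. x $ i $ j) = 1"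
    using x unfolding Lambda_crossing by blast+
  \<comment> \<open>the inverse of a zero coordinate is zero, so the sum bounds the inverses of the others\<close>
  define N where "N = Suc (CARD('n \<times> 'n)) + nat \<lceil>\<Sum>(i, j)\<in>UNIV. inverse (x $ i $ j)\<rceil>"
  have N: "0 < N" "CARD('n \<times> 'n) < N"
    by (simp_all add: N_def)
  have small: "1 / real N \<le> x $ i $ j" if "x $ i $ j \<noteq> 0" for i j
  proof -
    have pos: "0 < x $ i $ j"
      using that nonneg[of i j] by simp
    have "inverse (x $ i $ j) \<le> (\<Sum>(i, j)\<in>UNIV. inverse (x $ i $ j))"
      using member_le_sum[of "(i, j)" UNIV "\<lambda>(i, j). inverse (x $ i $ j)"] nonneg by auto
    also have "\<dots> \<le> real N"
      unfolding N_def by linarith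
    finally show ?thesis
      using pos N(1) by (simp add: field_simps)
  qed
  obtain q P where q: "0 < q"
    and P: "\<And>ij. \<bar>real q * (x $ fst ij $ snd ij) - of_int (P ij)\<bar> < 1 / real N"
    using simultaneous_approximation[OF N(1), of "\<lambda>ij. x $ fst ij $ snd ij"] by blast
  have N1: "1 / real N \<le> 1"
    using N(1) by simp
  have P_zero: "P (i, j) = 0" if "x $ i $ j = 0" for i j
    using P[of "(i, j)"] that N1 by simp
  have P_nonneg: "0 \<le> P (i, j)" for i j
  proof -
    have "0 \<le> real q * x $ i $ j"
      using nonneg[of i j] by simp
    then have "- 1 < real_of_int (P (i, j))"
      using P[of "(i, j)"] N1 by simp
    then show ?thesis
      by simp
  qed
  have P_cross: "(\<Sum>ij\<in>crossing e. P ij) = int q" if e: "e \<in> E" for e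
  proof -
    have "\<bar>(\<Sum>ij\<in>crossing e. real q * (x $ fst ij $ snd ij) - of_int (P ij))\<bar> \<le>
        (\<Sum>ij\<in>crossing e. 1 / real N)"
      by (rule order_trans[OF sum_abs]) (intro sum_mono less_imp_le P)
    also have "\<dots> = real (card (crossing e)) / real N"
      by simp
    also have "\<dots> \<le> real CARD('n \<times> 'n) / real N"
      by (intro divide_right_mono of_nat_mono card_mono) simp_all
    also have "\<dots> < 1"
      using N(2) by (subst divide_less_eq_1_pos) (simp_all only: of_nat_less_iff of_nat_0_less_iff N(1))
    also have "(\<Sum>ij\<in>crossing e. real q * (x $ fst ij $ snd ij) - of_int (P ij)) =
        real_of_int (int q - (\<Sum>ij\<in>crossing e. P ij))"
      using cross[OF e] by (simp add: sum_subtractf case_prod_beta flip: sum_distrib_left)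
    finally show ?thesis
      by linarith
  qed
  define y :: "'n pair_vector" where "y = (\<chi> i j. of_int (P (i, j)) / real q)"
  have y_nth: "y $ i $ j = of_int (P (i, j)) / real q" for i j
    by (simp add: y_def)
  have y_cross: "(\<Sum>(i, j)\<in>crossing e. y $ i $ j) = 1" if "e \<in> E" for e
  proof -
    have "(\<Sum>(i, j)\<in>crossing e. y $ i $ j) = of_int (\<Sum>ij\<in>crossing e. P ij) / real q"
      by (simp add: y_nth case_prod_beta sum_divide_distrib)
    then show ?thesis
      using P_cross[OF that] q by simp
  qed
  have y: "y \<in> \<Lambda>"
    unfolding Lambda_crossing
  proof (intro conjI allI impI ballI)
    fix i j :: 'n
    show "y $ i $ j = 0" if "\<not> i < j"
      using upper[OF that] P_zero by (simp add: y_nth)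
    show "0 \<le> y $ i $ j"
      using P_nonneg by (simp add: y_nth)
  qed (rule y_cross)
  have close: "\<bar>x $ i $ j - y $ i $ j\<bar> < 1 / real N" for i j
  proof -
    have "real q * x $ i $ j - of_int (P (i, j)) = real q * (x $ i $ j - y $ i $ j)"
      using q by (simp add: y_nth right_diff_distrib)
    then have "\<bar>real q * x $ i $ j - of_int (P (i, j))\<bar> = real q * \<bar>x $ i $ j - y $ i $ j\<bar>"
      by (simp add: abs_mult)
    moreover have "1 * \<bar>x $ i $ j - y $ i $ j\<bar> \<le> real q * \<bar>x $ i $ j - y $ i $ j\<bar>"
      using q by (intro mult_right_mono) simp_all
    ultimately have "\<bar>x $ i $ j - y $ i $ j\<bar> \<le> \<bar>real q * x $ i $ j - of_int (P (i, j))\<bar>"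
      by simp
    also have "\<dots> < 1 / real N"
      using P[of "(i, j)"] by simp
    finally show ?thesis .
  qed
  define z where "z = 2 *\<^sub>R x - y"
  have "z \<in> \<Lambda>"
    unfolding Lambda_crossing
  proof (intro conjI allI impI ballI)
    fix i j :: 'n
    show "z $ i $ j = 0" if "\<not> i < j"
      using upper[OF that] P_zero by (simp add: z_def y_nth)
    show "0 \<le> z $ i $ j"
    proof (cases "x $ i $ j = 0")
      case True
      then show ?thesis
        using P_zero by (simp add: z_def y_nth)
    next
      case False
      then show ?thesis
        using small[OF False] close[of i j] by (simp add: z_def)
    qed
  next
    fix e assume e: "e \<in> E"
    have "(\<Sum>(i, j)\<in>crossing e. z $ i $ j) =
        2 * (\<Sum>(i, j)\<in>crossing e. x $ i $ j) - (\<Sum>(i, j)\<in>crossing e. y $ i $ j)"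
      by (simp add: z_def case_prod_beta sum_subtractf sum_distrib_left)
    then show "(\<Sum>(i, j)\<in>crossing e. z $ i $ j) = 1"
      using cross[OF e] y_cross[OF e] by simp
  qed
  moreover have mid: "midpoint y z = x"
    by (simp add: midpoint_def z_def)
  ultimately have "y = z"
    using ext y midpoint_in_open_segment[of y z] unfolding extreme_point_of_def by metis
  then have "y = x"
    using mid by simp
  then have "real q * x $ i $ j = real (nat (P (i, j)))" for i j
    using q P_nonneg y_nth[of i j] by (simp add: field_simps)
  then show thesis
    using that[of q "\<lambda>i j. nat (P (i, j))"] q by blast
qed

text \<open>With \<open>c = k * x\<close> and \<open>w\<close> its symmetrisation, there is a closed sequence that makes the step from
  \<open>i\<close> to \<open>j\<close> exactly \<open>w i j\<close> times. All conditions on a multi-tour count steps whose ends satisfy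
  some relation, and each such count is a sum of entries of \<open>w\<close>. For the cuts it equals \<open>k\<close>, and the
  cut of a single point gives the number of visits to it.\<close>

lemma extreme_point_multi_tour:
  assumes ext: "x extreme_point_of \<Lambda>"
  shows "\<exists>k \<pi>. corresponding_multi_tour p V E M x k \<pi>"
proof -
  obtain k and c :: "'n \<Rightarrow> 'n \<Rightarrow> nat" where k: "0 < k" and c: "\<And>i j. real k * x $ i $ j = real (c i j)"
    using extreme_point_rational[OF ext] by blast
  have x: "x \<in> \<Lambda>"
    using ext by (simp add: extreme_point_of_def)
  have upper: "\<And>i j. \<not> i < j \<Longrightarrow> x $ i $ j = 0"
    and cut: "\<And>S. S \<in> splits \<Longrightarrow> (\<Sum>i\<in>S. \<Sum>j\<in>- S. x $ i $ j + x $ j $ i) = 1"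
    using x unfolding Lambda_cut by blast+
  have c_upper: "c i j = 0" if "\<not> i < j" for i j
    using c[of i j] upper[OF that] by simp
  define w where "w i j = c i j + c j i" for i j
  have w_real: "real (w i j) = real k * (x $ i $ j + x $ j $ i)" for i j
    using c[of i j] c[of j i] by (simp add: w_def distrib_left)
  have w_cut: "(\<Sum>i\<in>S. \<Sum>j\<in>- S. w i j) = k" if "S \<in> splits" for S
  proof -
    have "real (\<Sum>i\<in>S. \<Sum>j\<in>- S. w i j) = real k * (\<Sum>i\<in>S. \<Sum>j\<in>- S. x $ i $ j + x $ j $ i)"
      by (simp add: w_real sum_distrib_left)
    then have "real (\<Sum>i\<in>S. \<Sum>j\<in>- S. w i j) = real k"
      using cut[OF that] by (simp only: mult_1_right)
    then show ?thesis
      by (simp only: of_nat_eq_iff)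
  qed
  have w_loop: "w i i = 0" for i
    by (simp add: w_def c_upper)
  have w_row: "(\<Sum>j\<in>UNIV. w i j) = k" for i
  proof -
    have "(\<Sum>j\<in>UNIV. w i j) = (\<Sum>j\<in>- {i}. w i j)"
      by (rule sum.mono_neutral_right) (auto simp: w_loop)
    then show ?thesis
      using w_cut[OF singleton, of i] by simp
  qed
  have connected: "A = UNIV" if "A \<noteq> {}" "\<And>i j. i \<in> A \<Longrightarrow> j \<notin> A \<Longrightarrow> w i j = 0" for A
  proof (rule unit_cut_connected[of "\<lambda>i j. x $ i $ j + x $ j $ i"])
    show "x $ i $ j + x $ j $ i = 0" if "i \<in> A" "j \<notin> A" for i j
      using w_real[of i j] \<open>\<And>i j. i \<in> A \<Longrightarrow> j \<notin> A \<Longrightarrow> w i j = 0\<close>[OF that] k by simp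
  qed (use that(1) cut in \<open>auto simp: add.commute\<close>)
  obtain N f where f: "f N = f 0"
    and count: "\<And>R. card {t. t < N \<and> (f t, f (Suc t)) \<in> R} = (\<Sum>(i, j)\<in>R. w i j)"
    using exists_closed_sequence[of w] w_loop connected by (auto simp: w_def add.commute)
  have N: "N = card M * k"
  proof -
    have "N = (\<Sum>(i, j)\<in>UNIV. w i j)"
      using count[of UNIV] by simp
    also have "\<dots> = (\<Sum>i\<in>UNIV. \<Sum>j\<in>UNIV. w i j)"
      by (simp add: sum.cartesian_product)
    finally show ?thesis
      by (simp add: w_row card_M)
  qed
  define \<pi> where "\<pi> t = p (f t)" for t
  have next_\<pi>: "\<pi> ((t + 1) mod N) = p (f (Suc t))" if "t < N" for t
  proof (cases "Suc t = N")
    case True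
    then show ?thesis
      using f by (simp add: \<pi>_def)
  next
    case False
    then show ?thesis
      using that by (simp add: \<pi>_def)
  qed
  have count': "card {t. t < N \<and> Q (\<pi> t) (\<pi> ((t + 1) mod N))} = (\<Sum>(i, j) | Q (p i) (p j). w i j)" for Q
  proof -
    have "{t. t < N \<and> Q (\<pi> t) (\<pi> ((t + 1) mod N))} = {t. t < N \<and> (f t, f (Suc t)) \<in> {(i, j). Q (p i) (p j)}}"
      using next_\<pi> by (auto simp: \<pi>_def)
    then show ?thesis
      by (simp only: count)
  qed
  have visits: "card {t. t < N \<and> \<pi> t = u} = k" if u: "u \<in> M" for u
  proof -
    obtain i where i: "u = p i"
      using p_obtain[OF u] .
    have "{(a, b). p a = u} = {i} \<times> (UNIV :: 'n set)"
      using i by auto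
    then have "card {t. t < N \<and> \<pi> t = u} = (\<Sum>(a, b)\<in>{i} \<times> UNIV. w a b)"
      using count'[of "\<lambda>a b. a = u"] by (simp only:)
    also have "\<dots> = k"
      by (simp add: w_row flip: sum.cartesian_product)
    finally show ?thesis .
  qed
  have steps: "\<pi> t \<noteq> \<pi> ((t + 1) mod N)" if t: "t < N" for t
  proof
    assume stay: "\<pi> t = \<pi> ((t + 1) mod N)"
    let ?S = "{t. t < N \<and> \<pi> t = \<pi> ((t + 1) mod N)}"
    have "card ?S = 0"
      unfolding count'[of "(=)"] by (auto simp: w_loop)
    moreover have "finite ?S"
      by (rule finite_subset[of _ "{..<N}"]) auto
    ultimately have "?S = {}"
      by (rule card_0_eq[THEN iffD1, rotated])
    then show False
      using t stay by blast
  qed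
  have crossings: "card {t. t < N \<and> \<pi> t \<in> A \<and> \<pi> ((t + 1) mod N) \<notin> A} = k"
    if "e \<in> E" "A \<in> edge_partition V E M e" for e A
  proof -
    have "p -` A \<in> splits"
      using that splits_iff by blast
    moreover have "{(i, j). p i \<in> A \<and> p j \<notin> A} = (p -` A) \<times> (- (p -` A))"
      by auto
    ultimately show ?thesis
      unfolding count'[of "\<lambda>u v. u \<in> A \<and> v \<notin> A"] using w_cut by (simp flip: sum.cartesian_product)
  qed
  have tour: "multi_tour V E M k \<pi>"
    unfolding multi_tour_def multi_cyclic_order_def Let_def N[symmetric]
    using k visits steps crossings by (auto simp: \<pi>_def)
  have "x = (1 / (2 * real k)) *\<^sub>R tour_vector p M k \<pi>"
  proof -
    have "x $ i $ j = 1 / (2 * real k) * (tour_vector p M k \<pi> $ i $ j)" for i j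
    proof (cases "i < j")
      case True
      have "{(a, b). {p a, p b} = {p i, p j}} = {(i, j), (j, i)}"
        by (auto simp: doubleton_eq_iff)
      then have "card {t. t < N \<and> {\<pi> t, \<pi> ((t + 1) mod N)} = {p i, p j}} = 2 * c i j"
        using count'[of "\<lambda>u v. {u, v} = {p i, p j}"] True c_upper[of j i] by (simp add: w_def)
      then have "tour_vector p M k \<pi> $ i $ j = 2 * real (c i j)"
        using True by (simp add: tour_vector_def Let_def flip: N)
      then show ?thesis
        using c[of i j] k by (simp add: field_simps)
    next
      case False
      then show ?thesis
        by (simp add: tour_vector_def Let_def upper)
    qed
    then show ?thesis
      by (simp add: vec_eq_iff)
  qed
  then show ?thesis
    using tour by (auto simp: corresponding_multi_tour_def)
qed

end

section \<open>Duality between fillings and the polyhedron\<close>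

context indexed_tree
begin

definition objective_vector :: "('v \<Rightarrow> 'v \<Rightarrow> real) \<Rightarrow> 'n pair_vector" where
  "objective_vector \<rho> = (\<chi> i j. if i < j then \<rho> (p i) (p j) else 0)"

definition crossing_vector :: "'v set \<Rightarrow> 'n pair_vector" where
  "crossing_vector e = (\<chi> i j. if (i, j) \<in> crossing e then 1 else 0)"

lemma inner_pair_vector: "x \<bullet> y = (\<Sum>(i, j)\<in>UNIV. x $ i $ j * y $ i $ j)"
  for x y :: "'n pair_vector"
  by (simp add: inner_vec_def sum.cartesian_product)

lemma objective_inner: "objective p \<rho> x = objective_vector \<rho> \<bullet> x"
  unfolding objective_def inner_pair_vector
  by (rule sum.mono_neutral_cong_left) (auto simp: objective_vector_def split: if_splits)

lemma crossing_inner: "crossing_vector e \<bullet> x = (\<Sum>(i, j)\<in>crossing e. x $ i $ j)"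
  unfolding inner_pair_vector
  by (rule sum.mono_neutral_cong_right) (auto simp: crossing_vector_def)

lemma gen_filling_iff:
  "gen_filling p \<rho> E \<omega> \<longleftrightarrow>
     (\<forall>i j. i < j \<longrightarrow> \<rho> (p i) (p j) \<le> (\<Sum>e\<in>E. \<omega> e * crossing_vector e $ i $ j))"
proof -
  have "(\<Sum>e\<in>tree_path E (p i) (p j). \<omega> e) = (\<Sum>e\<in>E. \<omega> e * crossing_vector e $ i $ j)" if "i < j" for i j
    unfolding tree_path_eq[OF p_in p_in] using that finite_E
    by (intro sum.mono_neutral_cong_left) (auto simp: crossing_vector_def crossing_def)
  then show ?thesis
    by (simp add: gen_filling_def)
qed

text \<open>Weak duality: weight the inequalities of the filling with the entries of \<open>x\<close> and exchange the
  sums.\<close>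

lemma objective_le_filling:
  assumes \<omega>: "gen_filling p \<rho> E \<omega>" and x: "x \<in> \<Lambda>"
  shows "objective p \<rho> x \<le> (\<Sum>e\<in>E. \<omega> e)"
proof -
  have "objective p \<rho> x \<le> (\<Sum>(i, j) | i < j. \<Sum>e\<in>E. \<omega> e * crossing_vector e $ i $ j * x $ i $ j)"
    unfolding objective_def
  proof (intro sum_mono, clarify)
    fix i j :: 'n assume "i < j"
    then show "\<rho> (p i) (p j) * x $ i $ j \<le> (\<Sum>e\<in>E. \<omega> e * crossing_vector e $ i $ j * x $ i $ j)"
      using \<omega> x unfolding gen_filling_iff Lambda_crossing sum_distrib_right[symmetric]
      by (simp add: mult_right_mono)
  qed
  also have "\<dots> = (\<Sum>(i, j)\<in>UNIV. \<Sum>e\<in>E. \<omega> e * crossing_vector e $ i $ j * x $ i $ j)"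
  proof (rule sum.mono_neutral_left)
    show "\<forall>ij\<in>UNIV - {(i, j). i < j}.
        (case ij of (i, j) \<Rightarrow> \<Sum>e\<in>E. \<omega> e * crossing_vector e $ i $ j * x $ i $ j) = 0"
    proof
      fix ij :: "'n \<times> 'n" assume "ij \<in> UNIV - {(i, j). i < j}"
      then have "x $ fst ij $ snd ij = 0"
        using x unfolding Lambda_crossing by (cases ij) simp
      then show "(case ij of (i, j) \<Rightarrow> \<Sum>e\<in>E. \<omega> e * crossing_vector e $ i $ j * x $ i $ j) = 0"
        by (simp add: case_prod_beta)
    qed
  qed simp_all
  also have "\<dots> = (\<Sum>e\<in>E. \<omega> e * (crossing_vector e \<bullet> x))"
    unfolding inner_pair_vector case_prod_beta
    by (subst sum.swap) (simp add: sum_distrib_left mult.assoc)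
  also have "\<dots> = (\<Sum>e\<in>E. \<omega> e)"
    using x unfolding crossing_inner Lambda_crossing by simp
  finally show ?thesis .
qed

text \<open>Duality is applied on the whole space of matrices. The vectors of the program vanish outside the
  strictly upper triangle, so a nonnegative matrix may be replaced by its upper part \<open>up x\<close>. A direction of
  recession has zero upper part, because every pair \<open>i < j\<close> is separated by the edge at \<open>p i\<close>.\<close>

lemma exists_optimal_filling:
  assumes max: "\<And>x. x \<in> \<Lambda> \<Longrightarrow> objective p \<rho> x \<le> m"
  shows "\<exists>\<omega>. gen_filling p \<rho> E \<omega> \<and> (\<Sum>e\<in>E. \<omega> e) \<le> m"
proof -
  define up :: "'n pair_vector \<Rightarrow> 'n pair_vector" where "up x = (\<chi> i j. if i < j then x $ i $ j else 0)" for x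
  have coord: "axis i (axis j 1) \<in> (Basis :: 'n pair_vector set)" for i j
    by (auto simp: Basis_vec_def)
  have nth: "x \<bullet> axis i (axis j 1) = x $ i $ j" for x :: "'n pair_vector" and i j
    by (simp add: inner_axis)
  have up_nonneg: "0 \<le> up x $ i $ j" if "\<forall>b\<in>Basis. 0 \<le> x \<bullet> b" for x i j
    using bspec[OF that coord, of i j] unfolding nth by (simp add: up_def)
  have up_upper: "up x $ i $ j = 0" if "\<not> i < j" for x i j
    using that by (simp add: up_def)
  have up_cross: "(\<Sum>(i, j)\<in>crossing e. up x $ i $ j) = crossing_vector e \<bullet> x" for e x
    unfolding crossing_inner by (intro sum.cong refl) (auto simp: up_def crossing_def)
  have up_objective: "objective p \<rho> (up x) = objective_vector \<rho> \<bullet> x" for x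
    unfolding objective_inner[of \<rho> x, symmetric] objective_def
    by (intro sum.cong refl) (auto simp: up_def)
  have "\<exists>\<omega>. (\<forall>b\<in>Basis. objective_vector \<rho> \<bullet> b \<le> (\<Sum>e\<in>E. \<omega> e * (crossing_vector e \<bullet> b))) \<and>
      (\<Sum>e\<in>E. \<omega> e) \<le> m"
  proof (rule lp_duality[OF finite_E])
    fix x :: "'n pair_vector"
    assume x: "\<forall>b\<in>Basis. 0 \<le> x \<bullet> b" "\<forall>e\<in>E. crossing_vector e \<bullet> x = 1"
    have "up x \<in> \<Lambda>"
      unfolding Lambda_crossing using up_nonneg[OF x(1)] up_upper up_cross x(2) by simp
    from max[OF this] show "objective_vector \<rho> \<bullet> x \<le> m"
      by (simp add: up_objective)
  next
    fix x :: "'n pair_vector"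
    assume x: "\<forall>b\<in>Basis. 0 \<le> x \<bullet> b" "\<forall>e\<in>E. crossing_vector e \<bullet> x = 0"
    have "up x $ i $ j = 0" for i j
    proof (cases "i < j")
      case True
      obtain e A where e: "e \<in> E" "A \<in> edge_partition V E M e" "{i} = p -` A"
        using singleton[of i] unfolding splits_iff by blast
      have "(i, j) \<in> crossing e"
        using True separates_split[OF e(1,2), of i j] unfolding e(3)[symmetric] by (simp add: crossing_def)
      moreover have "(\<Sum>ij\<in>crossing e. up x $ fst ij $ snd ij) = 0"
        using x(2) e(1) up_cross[of x e] by (simp add: case_prod_beta)
      ultimately show ?thesis
        using up_nonneg[OF x(1)] by (force simp: sum_nonneg_eq_0_iff)
    qed (simp add: up_def)
    then have "objective p \<rho> (up x) = 0"
      by (simp add: objective_def)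
    then show "objective_vector \<rho> \<bullet> x \<le> 0"
      by (simp add: up_objective)
  qed
  then obtain \<omega> where \<omega>: "\<And>b. b \<in> Basis \<Longrightarrow> objective_vector \<rho> \<bullet> b \<le> (\<Sum>e\<in>E. \<omega> e * (crossing_vector e \<bullet> b))"
      "(\<Sum>e\<in>E. \<omega> e) \<le> m"
    by blast
  have "gen_filling p \<rho> E \<omega>"
    unfolding gen_filling_iff
  proof (intro allI impI)
    fix i j :: 'n assume "i < j"
    then show "\<rho> (p i) (p j) \<le> (\<Sum>e\<in>E. \<omega> e * crossing_vector e $ i $ j)"
      using \<omega>(1)[OF coord[of i j]] unfolding nth by (simp add: objective_vector_def)
  qed
  then show ?thesis
    using \<omega>(2) by blast
qed

lemma mpf_minus_eq:
  assumes "x \<in> \<Lambda>" and max: "\<And>y. y \<in> \<Lambda> \<Longrightarrow> objective p \<rho> y \<le> objective p \<rho> x"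
  shows "mpf_minus p \<rho> E = ereal (objective p \<rho> x)"
  unfolding mpf_minus_def
proof (rule antisym)
  show "ereal (objective p \<rho> x) \<le> (INF \<omega>\<in>{\<omega>. gen_filling p \<rho> E \<omega>}. ereal (\<Sum>e\<in>E. \<omega> e))"
    using objective_le_filling assms(1) by (intro INF_greatest) simp
  obtain \<omega> where \<omega>: "gen_filling p \<rho> E \<omega>" "(\<Sum>e\<in>E. \<omega> e) \<le> objective p \<rho> x"
    using exists_optimal_filling[OF max] by blast
  then have "(INF \<omega>\<in>{\<omega>. gen_filling p \<rho> E \<omega>}. ereal (\<Sum>e\<in>E. \<omega> e)) \<le> ereal (\<Sum>e\<in>E. \<omega> e)"
    by (intro INF_lower) simp
  also have "\<dots> \<le> ereal (objective p \<rho> x)"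
    using \<omega>(2) by simp
  finally show "(INF \<omega>\<in>{\<omega>. gen_filling p \<rho> E \<omega>}. ereal (\<Sum>e\<in>E. \<omega> e)) \<le> ereal (objective p \<rho> x)" .
qed

lemma maximal_extreme_point:
  obtains x where "x extreme_point_of \<Lambda>" "\<And>y. y \<in> \<Lambda> \<Longrightarrow> objective p \<rho> y \<le> objective p \<rho> x"
proof -
  have "continuous_on \<Lambda> (objective p \<rho>)"
    unfolding objective_inner by (intro continuous_intros)
  then obtain z where z: "z \<in> \<Lambda>" "\<And>y. y \<in> \<Lambda> \<Longrightarrow> objective p \<rho> y \<le> objective p \<rho> z"
    using continuous_attains_sup[OF compact_Lambda Lambda_nonempty] by blast
  define T where "T = \<Lambda> \<inter> {x. objective_vector \<rho> \<bullet> x = objective p \<rho> z}"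
  have face: "T face_of \<Lambda>"
    unfolding T_def using z(2)
    by (intro face_of_Int_supporting_hyperplane_le convex_Lambda) (simp add: objective_inner)
  have "compact T" "convex T"
    using face_of_imp_compact[OF convex_Lambda compact_Lambda face] face_of_imp_convex[OF face] by auto
  moreover have "z \<in> T"
    using z(1) by (simp add: T_def objective_inner)
  ultimately obtain x where x: "x extreme_point_of T"
    using extreme_point_exists_convex by blast
  then have "x extreme_point_of \<Lambda>" "x \<in> T"
    using extreme_point_of_face[OF face] by blast+
  then show thesis
    using that z(2) by (simp add: T_def objective_inner)
qed

text \<open>Double counting of the pairs of a step \<open>t\<close> and a pair \<open>i < j\<close> with \<open>{p i, p j}\<close> the unordered pair of
  ends of that step: each step has exactly one such pair.\<close>

lemma tour_objective_eq_perimeter: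
  assumes sym: "\<And>u v. \<rho> u v = \<rho> v u" and tour: "corresponding_multi_tour p V E M x k \<pi>"
  shows "objective p \<rho> x = multi_perimeter \<rho> M k \<pi>"
proof -
  define N where "N = card M * k"
  have \<pi>_in: "\<pi> t \<in> M" and \<pi>_step: "\<pi> t \<noteq> \<pi> ((t + 1) mod N)" if "t < N" for t
    using tour that
    by (auto simp: corresponding_multi_tour_def multi_tour_def multi_cyclic_order_def Let_def N_def)
  have x: "x = (1 / (2 * real k)) *\<^sub>R tour_vector p M k \<pi>"
    using tour by (simp add: corresponding_multi_tour_def)
  let ?U = "\<lambda>t. {\<pi> t, \<pi> ((t + 1) mod N)}"
  have edge: "(\<Sum>(i, j) | i < j. \<rho> (p i) (p j) * of_bool (?U t = {p i, p j})) = \<rho> (\<pi> t) (\<pi> ((t + 1) mod N))"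
    if t: "t < N" for t
  proof -
    have "(t + 1) mod N < N"
      using t by simp
    then obtain a b where ab: "\<pi> t = p a" "\<pi> ((t + 1) mod N) = p b"
      using p_obtain \<pi>_in t by metis
    then have "a \<noteq> b"
      using \<pi>_step[OF t] by auto
    define i j where "i = min a b" and "j = max a b"
    have ij: "i < j" "{p a, p b} = {p i, p j}" "\<rho> (p i) (p j) = \<rho> (p a) (p b)"
      using \<open>a \<noteq> b\<close> sym[of "p a" "p b"] by (auto simp: i_def j_def min_def max_def)
    have only: "c = i \<and> d = j" if "c < d" "{p i, p j} = {p c, p d}" for c d
      using that ij(1) by (auto simp: doubleton_eq_iff)
    have "(\<Sum>(c, d) | c < d. \<rho> (p c) (p d) * of_bool (?U t = {p c, p d})) =
        (\<Sum>(c, d)\<in>{(i, j)}. \<rho> (p c) (p d) * of_bool (?U t = {p c, p d}))"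
      using only ij(1) unfolding ab ij(2) by (intro sum.mono_neutral_right) auto
    then show ?thesis
      using ij unfolding ab by simp
  qed
  have "objective p \<rho> x =
      1 / (2 * real k) * (\<Sum>(i, j) | i < j. \<rho> (p i) (p j) * real (card {t. t < N \<and> ?U t = {p i, p j}}))"
    unfolding objective_def x sum_distrib_left
    by (intro sum.cong refl) (auto simp: tour_vector_def Let_def N_def)
  also have "(\<Sum>(i, j) | i < j. \<rho> (p i) (p j) * real (card {t. t < N \<and> ?U t = {p i, p j}})) =
      (\<Sum>(i, j) | i < j. \<Sum>t<N. \<rho> (p i) (p j) * of_bool (?U t = {p i, p j}))"
  proof (intro sum.cong refl, clarify)
    fix i j
    have "real (card {t. t < N \<and> ?U t = {p i, p j}}) = (\<Sum>t<N. of_bool (?U t = {p i, p j}))"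
      by (simp add: Int_def lessThan_def of_bool_def flip: sum.inter_filter card_eq_sum)
    then show "\<rho> (p i) (p j) * real (card {t. t < N \<and> ?U t = {p i, p j}}) =
        (\<Sum>t<N. \<rho> (p i) (p j) * of_bool (?U t = {p i, p j}))"
      by (simp add: sum_distrib_left)
  qed
  also have "\<dots> = (\<Sum>t<N. \<Sum>(i, j) | i < j. \<rho> (p i) (p j) * of_bool (?U t = {p i, p j}))"
    unfolding case_prod_beta by (rule sum.swap)
  also have "\<dots> = (\<Sum>t<N. \<rho> (\<pi> t) (\<pi> ((t + 1) mod N)))"
    by (intro sum.cong refl edge) simp
  finally show ?thesis
    by (simp add: multi_perimeter_def Let_def N_def)
qed

end

theorem mainTheorem1:
  fixes M V :: "'v set" and E :: "'v set set"
    and \<rho> :: "'v \<Rightarrow> 'v \<Rightarrow> real"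
    and p :: "'n::{finite,linorder} \<Rightarrow> 'v"
  assumes "Metric_space M \<rho>"
    and "bij_betw p UNIV M"
    and "binary_tree V E"
    and "connects V E M"
  shows "(\<exists>x. is_arg_max (objective p \<rho>) (\<lambda>y. y extreme_point_of Lambda_polyhedron p V E M) x \<and>
            mpf_minus p \<rho> E = ereal (objective p \<rho> x)) \<and>
         (\<forall>x. is_arg_max (objective p \<rho>) (\<lambda>y. y extreme_point_of Lambda_polyhedron p V E M) x \<longrightarrow>
            (\<exists>k \<pi>. corresponding_multi_tour p V E M x k \<pi>) \<and>
            (\<forall>k \<pi>. corresponding_multi_tour p V E M x k \<pi> \<longrightarrow>
               mpf_minus p \<rho> E = ereal (multi_perimeter \<rho> M k \<pi>)))"
proof -
  interpret indexed_tree V E M p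
    using assms(2-4) by unfold_locales
  have sym: "\<rho> u v = \<rho> v u" for u v
    using Metric_space.commute[OF assms(1)] .
  obtain z where z: "z extreme_point_of \<Lambda>" "\<And>y. y \<in> \<Lambda> \<Longrightarrow> objective p \<rho> y \<le> objective p \<rho> z"
    using maximal_extreme_point by blast
  have extreme_in: "y \<in> \<Lambda>" if "y extreme_point_of \<Lambda>" for y
    using that by (simp add: extreme_point_of_def)
  have mpf: "mpf_minus p \<rho> E = ereal (objective p \<rho> z)"
    using mpf_minus_eq extreme_in[OF z(1)] z(2) by blast
  have z_max: "is_arg_max (objective p \<rho>) (\<lambda>y. y extreme_point_of \<Lambda>) z"
    unfolding is_arg_max_def using z extreme_in by (auto simp: not_less)
  have maximum: "objective p \<rho> x = objective p \<rho> z"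
    if "is_arg_max (objective p \<rho>) (\<lambda>y. y extreme_point_of \<Lambda>) x" for x
    using that z extreme_in unfolding is_arg_max_def by (meson antisym not_le)
  show ?thesis
  proof (intro conjI allI impI)
    show "\<exists>x. is_arg_max (objective p \<rho>) (\<lambda>y. y extreme_point_of \<Lambda>) x \<and>
        mpf_minus p \<rho> E = ereal (objective p \<rho> x)"
      using z_max mpf by blast
  next
    fix x assume "is_arg_max (objective p \<rho>) (\<lambda>y. y extreme_point_of \<Lambda>) x"
    then show "\<exists>k \<pi>. corresponding_multi_tour p V E M x k \<pi>"
      using extreme_point_multi_tour by (simp add: is_arg_max_def)
  next
    fix x k \<pi>
    assume x: "is_arg_max (objective p \<rho>) (\<lambda>y. y extreme_point_of \<Lambda>) x"
      and tour: "corresponding_multi_tour p V E M x k \<pi>"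
    have "objective p \<rho> x = multi_perimeter \<rho> M k \<pi>"
      using sym tour by (rule tour_objective_eq_perimeter)
    then show "mpf_minus p \<rho> E = ereal (multi_perimeter \<rho> M k \<pi>)"
      using mpf maximum[OF x] by simp
  qed
qed

end
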